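(* The function $R\to\mathcal{D}'_c(R)$ given by $t\mapsto \frac12 S^t$ is a solution of the wave equation $\ddot Q(t)=\Delta(Q(t))$ (for all $t\in R$) in dimension 1; its initial value and initial speed are, respectively, $\delta(0)$ and $0$. The function $R\to\mathcal{D}'_c(R)$ given by $t\mapsto\frac12 B_t$ is a solution of the same wave equation; its initial value and initial speed are, respectively, $0$ and $\delta(0)$.
   Context: Setting: synthetic differential geometry. $R$ is the number line (a commutative ring object containing $\mathbb{Q}$ satisfying the Kock–Lawvere axiom, with the integration axiom: every $f$ has a unique antiderivative with given value at a point) in a well-adapted model; statements are read in the internal logic. $D=\{d\in R:d^2=0\}$. $\mathcal{D}'_c(R^n)$, the distributions of compact support on $R^n$, is the $R$-module of $R$-linear maps $R^{(R^n)}\to R$; evaluation is written $\langle\mu,\psi\rangle$. $\delta(0)$ is the Dirac distribution $\psi\mapsto\psi(0)$. The Laplace operator acts on distributions by $\langle\Delta(\mu),\psi\rangle=\langle\mu,\Delta\psi\rangle$; in dimension 1, $\Delta\psi=\psi''$. For $Q:R\to\mathcal{D}'_c(R^n)$, $\dot Q=\frac{d}{dt}Q$ is determined by $Q(t+d)=Q(t)+d\cdot\dot Q(t)$ for all $d\in D$, i.e. $\langle\dot Q(t),\psi\rangle=\frac{d}{dt}\langle Q(t),\psi\rangle$. The initial value is $Q(0)$ and the initial speed is $\dot Q(0)$. In dimension 1, for every $t\in R$: $\langle S^t,\psi\rangle=\psi(-t)+\psi(t)$ and $\langle B_t,\psi\rangle=\int_{-t}^{t}\psi(s)\,ds$ (with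 $\int_a^b=-\int_b^a$). *)

theory Defs
  imports Complex_Main "HOL-Algebra.Ring"
begin

text \<open>
  Classically the Kock--Lawvere axiom is refutable, so an axiomatisation of the line as a HOL type
  would be inconsistent. Here the line is a sheaf of rings on an arbitrary site, objects of
  maps are exponential sheaves, and internal statements are given by their Kripke--Joyal forcing
  clauses. Throughout, "at stage \<open>X\<close>" means "as a generalised element with domain \<open>X\<close>".
\<close>

section \<open>Sites and sheaves\<close>

text \<open>
  The objects and the arrows of the site are all the elements of the types \<open>'o\<close> and \<open>'m\<close>.
  \<open>Comp f g\<close> is "\<open>f\<close> after \<open>g\<close>" and only matters if \<open>Cod g = Dom f\<close>.
\<close>

record ('o, 'm) site =
  Dom :: "'m \<Rightarrow> 'o"
  Cod :: "'m \<Rightarrow> 'o"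
  Ident :: "'o \<Rightarrow> 'm"
  Comp :: "'m \<Rightarrow> 'm \<Rightarrow> 'm"  (infixl "\<odot>\<index>" 75)
  Cov :: "'o \<Rightarrow> 'm set set"

record ('o, 'm, 'a) presheaf =
  El :: "'o \<Rightarrow> 'a set"
  Res :: "'m \<Rightarrow> 'a \<Rightarrow> 'a"

definition sieve_on :: "('o, 'm) site \<Rightarrow> 'o \<Rightarrow> 'm set \<Rightarrow> bool" where
  "sieve_on C X S \<longleftrightarrow>
     (\<forall>f\<in>S. Cod C f = X) \<and> (\<forall>f\<in>S. \<forall>g. Cod C g = Dom C f \<longrightarrow> Comp C f g \<in> S)"

definition pull_sieve :: "('o, 'm) site \<Rightarrow> 'm \<Rightarrow> 'm set \<Rightarrow> 'm set" where
  "pull_sieve C f S = {g. Cod C g = Dom C f \<and> Comp C f g \<in> S}"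

locale grothendieck_site =
  fixes C :: "('o, 'm) site" (structure)
  assumes Dom_Ident: "Dom C (Ident C X) = X"
    and Cod_Ident: "Cod C (Ident C X) = X"
    and Dom_Comp: "Cod C g = Dom C f \<Longrightarrow> Dom C (f \<odot> g) = Dom C g"
    and Cod_Comp: "Cod C g = Dom C f \<Longrightarrow> Cod C (f \<odot> g) = Cod C f"
    and Comp_Ident: "f \<odot> Ident C (Dom C f) = f"
    and Ident_Comp: "Ident C (Cod C f) \<odot> f = f"
    and Comp_assoc:
      "Cod C g = Dom C f \<Longrightarrow> Cod C h = Dom C g \<Longrightarrow> (f \<odot> g) \<odot> h = f \<odot> (g \<odot> h)"
    and Cov_sieve: "S \<in> Cov C X \<Longrightarrow> sieve_on C X S"
    and Cov_maximal: "{f. Cod C f = X} \<in> Cov C X"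
    and Cov_stable: "S \<in> Cov C (Cod C f) \<Longrightarrow> pull_sieve C f S \<in> Cov C (Dom C f)"
    and Cov_transitive:
      "S \<in> Cov C X \<Longrightarrow> sieve_on C X T \<Longrightarrow> (\<And>f. f \<in> S \<Longrightarrow> pull_sieve C f T \<in> Cov C (Dom C f))
        \<Longrightarrow> T \<in> Cov C X"
begin

abbreviation dom where "dom \<equiv> Dom C"
abbreviation cod where "cod \<equiv> Cod C"
abbreviation ide where "ide \<equiv> Ident C"

definition is_presheaf :: "('o, 'm, 'a) presheaf \<Rightarrow> bool" where
  "is_presheaf A \<longleftrightarrow>
     (\<forall>f. \<forall>a\<in>El A (cod f). Res A f a \<in> El A (dom f)) \<and>
     (\<forall>X. \<forall>a\<in>El A X. Res A (ide X) a = a) \<and>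
     (\<forall>f g. cod g = dom f \<longrightarrow> (\<forall>a\<in>El A (cod f). Res A (f \<odot> g) a = Res A g (Res A f a)))"

definition is_sheaf :: "('o, 'm, 'a) presheaf \<Rightarrow> bool" where
  "is_sheaf A \<longleftrightarrow> is_presheaf A \<and>
     (\<forall>X. \<forall>S\<in>Cov C X. \<forall>fam.
        (\<forall>f\<in>S. fam f \<in> El A (dom f)) \<and>
        (\<forall>f\<in>S. \<forall>g. cod g = dom f \<longrightarrow> fam (f \<odot> g) = Res A g (fam f))
        \<longrightarrow> (\<exists>!a. a \<in> El A X \<and> (\<forall>f\<in>S. Res A f a = fam f)))"

subsection \<open>Subobjects, products, exponentials\<close>

definition subob :: "('o, 'm, 'a) presheaf \<Rightarrow> ('o \<Rightarrow> 'a \<Rightarrow> bool) \<Rightarrow> ('o, 'm, 'a) presheaf" where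
  "subob A P = \<lparr>El = (\<lambda>X. {a \<in> El A X. P X a}), Res = Res A\<rparr>"

definition prod_ob :: "('o, 'm, 'a) presheaf \<Rightarrow> ('o, 'm, 'b) presheaf \<Rightarrow> ('o, 'm, 'a \<times> 'b) presheaf"
  where "prod_ob A B =
    \<lparr>El = (\<lambda>X. El A X \<times> El B X), Res = (\<lambda>f. map_prod (Res A f) (Res B f))\<rparr>"

text \<open>
  An element \<open>\<theta>\<close> of the exponential at stage \<open>X\<close> is a natural transformation from \<open>y(X) \<times> A\<close> to \<open>B\<close>:
  for \<open>f : Y \<rightarrow> X\<close> and \<open>a \<in> A(Y)\<close>, \<open>\<theta> f a \<in> B(Y)\<close> is the value at \<open>a\<close> of the restriction of \<open>\<theta>\<close>
  along \<open>f\<close>. In particular \<open>\<theta> (ide X) a\<close> is the plain evaluation at stage \<open>X\<close>. Outside its domain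
  \<open>\<theta>\<close> is \<open>undefined\<close>, so that equality of elements is HOL equality.
\<close>

definition lam :: "'o \<Rightarrow> ('o, 'm, 'a) presheaf \<Rightarrow> ('m \<Rightarrow> 'a \<Rightarrow> 'b) \<Rightarrow> 'm \<Rightarrow> 'a \<Rightarrow> 'b" where
  "lam X A F = (\<lambda>f a. if cod f = X \<and> a \<in> El A (dom f) then F f a else undefined)"

definition expo ::
  "('o, 'm, 'a) presheaf \<Rightarrow> ('o, 'm, 'b) presheaf \<Rightarrow> ('o, 'm, 'm \<Rightarrow> 'a \<Rightarrow> 'b) presheaf" where
  "expo A B = \<lparr>
     El = (\<lambda>X. {\<theta>.
       (\<forall>f. cod f = X \<longrightarrow> (\<forall>a\<in>El A (dom f). \<theta> f a \<in> El B (dom f))) \<and>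
       (\<forall>f g. cod f = X \<longrightarrow> cod g = dom f \<longrightarrow>
          (\<forall>a\<in>El A (dom f). \<theta> (f \<odot> g) (Res A g a) = Res B g (\<theta> f a))) \<and>
       (\<forall>f a. \<not> (cod f = X \<and> a \<in> El A (dom f)) \<longrightarrow> \<theta> f a = undefined)}),
     Res = (\<lambda>h \<theta>. lam (dom h) A (\<lambda>f. \<theta> (h \<odot> f)))\<rparr>"

subsection \<open>Kripke--Joyal forcing\<close>

text \<open>
  A formula at stage \<open>X\<close> is given by \<open>\<phi>\<close> such that, for \<open>f : Y \<rightarrow> X\<close>, \<open>\<phi> f\<close> says that the formula, with
  its parameters restricted along \<open>f\<close>, is forced at \<open>Y\<close>; under a quantifier \<open>\<phi>\<close> also takes the bound
  element of stage \<open>Y\<close>. Equality and conjunction are forced pointwise.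
\<close>

definition kj_all :: "'o \<Rightarrow> ('o, 'm, 'a) presheaf \<Rightarrow> ('m \<Rightarrow> 'a \<Rightarrow> bool) \<Rightarrow> bool" where
  "kj_all X A \<phi> \<longleftrightarrow> (\<forall>f. cod f = X \<longrightarrow> (\<forall>a\<in>El A (dom f). \<phi> f a))"

definition kj_ex :: "'o \<Rightarrow> ('o, 'm, 'a) presheaf \<Rightarrow> ('m \<Rightarrow> 'a \<Rightarrow> bool) \<Rightarrow> bool" where
  "kj_ex X A \<phi> \<longleftrightarrow> (\<exists>S\<in>Cov C X. \<forall>f\<in>S. \<exists>a\<in>El A (dom f). \<phi> f a)"

definition kj_imp :: "'o \<Rightarrow> ('m \<Rightarrow> bool) \<Rightarrow> ('m \<Rightarrow> bool) \<Rightarrow> bool" where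
  "kj_imp X \<phi> \<psi> \<longleftrightarrow> (\<forall>f. cod f = X \<longrightarrow> \<phi> f \<longrightarrow> \<psi> f)"

definition kj_false :: "'o \<Rightarrow> bool" where
  "kj_false X \<longleftrightarrow> {} \<in> Cov C X"

definition kj_ex1 :: "'o \<Rightarrow> ('o, 'm, 'a) presheaf \<Rightarrow> ('m \<Rightarrow> 'a \<Rightarrow> bool) \<Rightarrow> bool" where
  "kj_ex1 X A \<phi> \<longleftrightarrow>
     kj_ex X A (\<lambda>f a. \<phi> f a \<and>
       kj_all (dom f) A (\<lambda>g b.
         kj_imp (dom g) (\<lambda>h. \<phi> (f \<odot> g \<odot> h) (Res A h b))
                        (\<lambda>h. Res A h b = Res A (g \<odot> h) a)))"

text \<open>
  Definite description. If \<open>A\<close> is a sheaf and unique existence is forced at \<open>X\<close>, the local witnesses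
  glue to exactly one element at stage \<open>X\<close>.
\<close>

definition the_el :: "'o \<Rightarrow> ('o, 'm, 'a) presheaf \<Rightarrow> ('a \<Rightarrow> bool) \<Rightarrow> 'a" where
  "the_el X A P = (THE a. a \<in> El A X \<and> P a)"

end


section \<open>The number line\<close>

definition rat_ring :: "rat ring" where
  "rat_ring = \<lparr>carrier = UNIV, mult = (*), one = 1, zero = 0, add = (+)\<rparr>"

record ('o, 'm, 'r) sring =
  ring_at :: "'o \<Rightarrow> 'r ring"
  restr :: "'m \<Rightarrow> 'r \<Rightarrow> 'r"
  of_q :: "'o \<Rightarrow> rat \<Rightarrow> 'r"

locale ring_object = grothendieck_site C for C :: "('o, 'm) site" (structure) +
  fixes L :: "('o, 'm, 'r) sring"
begin

abbreviation RR where "RR \<equiv> ring_at L"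
abbreviation \<rho> where "\<rho> \<equiv> restr L"

definition line :: "('o, 'm, 'r) presheaf" where
  "line = \<lparr>El = (\<lambda>X. carrier (RR X)), Res = \<rho>\<rparr>"

text \<open>A commutative ring object, with a monomorphism of rings from the constant sheaf of rationals.\<close>

definition is_Q_ring :: bool where
  "is_Q_ring \<longleftrightarrow>
     is_sheaf line \<and>
     (\<forall>X. cring (RR X)) \<and>
     (\<forall>f. \<rho> f \<in> ring_hom (RR (cod f)) (RR (dom f))) \<and>
     (\<forall>X. of_q L X \<in> ring_hom rat_ring (RR X)) \<and>
     (\<forall>f q. \<rho> f (of_q L (cod f) q) = of_q L (dom f) q) \<and>
     (\<forall>X p q. p \<noteq> q \<longrightarrow>
        kj_imp X (\<lambda>f. \<rho> f (of_q L X p) = \<rho> f (of_q L X q)) (\<lambda>f. kj_false (dom f)))"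

definition infin :: "('o, 'm, 'r) presheaf" where
  "infin = subob line (\<lambda>X d. d \<otimes>\<^bsub>RR X\<^esub> d = \<zero>\<^bsub>RR X\<^esub>)"

definition Kock_Lawvere :: bool where
  "Kock_Lawvere \<longleftrightarrow> (\<forall>X.
     kj_all X (expo infin line) (\<lambda>f \<theta>.
       kj_ex1 (dom f) (prod_ob line line) (\<lambda>g (a, b).
         kj_all (dom g) infin (\<lambda>h d.
           \<theta> (g \<odot> h) d = \<rho> h a \<oplus>\<^bsub>RR (dom h)\<^esub> d \<otimes>\<^bsub>RR (dom h)\<^esub> \<rho> h b))))"

subsection \<open>Functions on the line\<close>

abbreviation fun_ob where "fun_ob \<equiv> expo line line"

definition padd ::
  "'o \<Rightarrow> ('o, 'm, 'a) presheaf \<Rightarrow> ('m \<Rightarrow> 'a \<Rightarrow> 'r) \<Rightarrow> ('m \<Rightarrow> 'a \<Rightarrow> 'r) \<Rightarrow> 'm \<Rightarrow> 'a \<Rightarrow> 'r" where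
  "padd X A \<theta> \<eta> = lam X A (\<lambda>f a. \<theta> f a \<oplus>\<^bsub>RR (dom f)\<^esub> \<eta> f a)"

definition pscale ::
  "'o \<Rightarrow> ('o, 'm, 'a) presheaf \<Rightarrow> 'r \<Rightarrow> ('m \<Rightarrow> 'a \<Rightarrow> 'r) \<Rightarrow> 'm \<Rightarrow> 'a \<Rightarrow> 'r" where
  "pscale X A r \<theta> = lam X A (\<lambda>f a. \<rho> f r \<otimes>\<^bsub>RR (dom f)\<^esub> \<theta> f a)"

definition pzero :: "'o \<Rightarrow> ('o, 'm, 'a) presheaf \<Rightarrow> 'm \<Rightarrow> 'a \<Rightarrow> 'r" where
  "pzero X A = lam X A (\<lambda>f a. \<zero>\<^bsub>RR (dom f)\<^esub>)"

definition is_deriv :: "'o \<Rightarrow> ('m \<Rightarrow> 'r \<Rightarrow> 'r) \<Rightarrow> ('m \<Rightarrow> 'r \<Rightarrow> 'r) \<Rightarrow> bool" where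
  "is_deriv X \<psi> \<psi>' \<longleftrightarrow>
     kj_all X line (\<lambda>f x. kj_all (dom f) infin (\<lambda>g d.
       \<psi> (f \<odot> g) (\<rho> g x \<oplus>\<^bsub>RR (dom g)\<^esub> d) =
       \<psi> (f \<odot> g) (\<rho> g x) \<oplus>\<^bsub>RR (dom g)\<^esub> d \<otimes>\<^bsub>RR (dom g)\<^esub> \<psi>' (f \<odot> g) (\<rho> g x)))"

text \<open>
  The descriptions below denote: unique existence at every stage follows from the Kock--Lawvere
  axiom for \<open>deriv\<close> and \<open>dot\<close>, and is the integration axiom for \<open>integral\<close>. Since
  \<open>integral X a b \<psi> = \<gamma>(b)\<close> for the antiderivative \<open>\<gamma>\<close> vanishing at \<open>a\<close>, there is no order condition
  on \<open>a\<close> and \<open>b\<close>, and reversing the limits changes the sign.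
\<close>

definition deriv :: "'o \<Rightarrow> ('m \<Rightarrow> 'r \<Rightarrow> 'r) \<Rightarrow> 'm \<Rightarrow> 'r \<Rightarrow> 'r" where
  "deriv X \<psi> = the_el X fun_ob (is_deriv X \<psi>)"

definition integration_axiom :: bool where
  "integration_axiom \<longleftrightarrow> (\<forall>X.
     kj_all X fun_ob (\<lambda>f \<psi>. kj_all (dom f) line (\<lambda>g a. kj_all (dom g) line (\<lambda>h c.
       kj_ex1 (dom h) fun_ob (\<lambda>k \<gamma>.
         is_deriv (dom k) \<gamma> (Res fun_ob (g \<odot> h \<odot> k) \<psi>) \<and>
         \<gamma> (ide (dom k)) (\<rho> (h \<odot> k) a) = \<rho> k c)))))"

definition integral :: "'o \<Rightarrow> 'r \<Rightarrow> 'r \<Rightarrow> ('m \<Rightarrow> 'r \<Rightarrow> 'r) \<Rightarrow> 'r" where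
  "integral X a b \<psi> =
     the_el X fun_ob (\<lambda>\<gamma>. is_deriv X \<gamma> \<psi> \<and> \<gamma> (ide X) a = \<zero>\<^bsub>RR X\<^esub>) (ide X) b"

subsection \<open>Distributions of compact support on the line\<close>

definition is_linear :: "'o \<Rightarrow> ('m \<Rightarrow> ('m \<Rightarrow> 'r \<Rightarrow> 'r) \<Rightarrow> 'r) \<Rightarrow> bool" where
  "is_linear X \<mu> \<longleftrightarrow>
     kj_all X fun_ob (\<lambda>f \<psi>. kj_all (dom f) fun_ob (\<lambda>g \<chi>.
       \<mu> (f \<odot> g) (padd (dom g) line (Res fun_ob g \<psi>) \<chi>) =
       \<mu> (f \<odot> g) (Res fun_ob g \<psi>) \<oplus>\<^bsub>RR (dom g)\<^esub> \<mu> (f \<odot> g) \<chi>)) \<and>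
     kj_all X line (\<lambda>f r. kj_all (dom f) fun_ob (\<lambda>g \<psi>.
       \<mu> (f \<odot> g) (pscale (dom g) line (\<rho> g r) \<psi>) =
       \<rho> g r \<otimes>\<^bsub>RR (dom g)\<^esub> \<mu> (f \<odot> g) \<psi>))"

definition distr :: "('o, 'm, 'm \<Rightarrow> ('m \<Rightarrow> 'r \<Rightarrow> 'r) \<Rightarrow> 'r) presheaf" where
  "distr = subob (expo fun_ob line) is_linear"

definition dirac0 :: "'o \<Rightarrow> 'm \<Rightarrow> ('m \<Rightarrow> 'r \<Rightarrow> 'r) \<Rightarrow> 'r" where
  "dirac0 X = lam X fun_ob (\<lambda>f \<psi>. \<psi> (ide (dom f)) \<zero>\<^bsub>RR (dom f)\<^esub>)"

definition zero_distr :: "'o \<Rightarrow> 'm \<Rightarrow> ('m \<Rightarrow> 'r \<Rightarrow> 'r) \<Rightarrow> 'r" where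
  "zero_distr X = pzero X fun_ob"

definition Laplace ::
  "'o \<Rightarrow> ('m \<Rightarrow> ('m \<Rightarrow> 'r \<Rightarrow> 'r) \<Rightarrow> 'r) \<Rightarrow> 'm \<Rightarrow> ('m \<Rightarrow> 'r \<Rightarrow> 'r) \<Rightarrow> 'r" where
  "Laplace X \<mu> = lam X fun_ob (\<lambda>f \<psi>. \<mu> f (deriv (dom f) (deriv (dom f) \<psi>)))"

subsection \<open>Evolving distributions and the wave equation\<close>

abbreviation evol_ob where "evol_ob \<equiv> expo line distr"

definition is_dot ::
  "'o \<Rightarrow> ('m \<Rightarrow> 'r \<Rightarrow> 'm \<Rightarrow> ('m \<Rightarrow> 'r \<Rightarrow> 'r) \<Rightarrow> 'r) \<Rightarrow>
    ('m \<Rightarrow> 'r \<Rightarrow> 'm \<Rightarrow> ('m \<Rightarrow> 'r \<Rightarrow> 'r) \<Rightarrow> 'r) \<Rightarrow> bool" where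
  "is_dot X Q Q' \<longleftrightarrow>
     kj_all X line (\<lambda>f t. kj_all (dom f) infin (\<lambda>g d.
       Q (f \<odot> g) (\<rho> g t \<oplus>\<^bsub>RR (dom g)\<^esub> d) =
       padd (dom g) fun_ob (Q (f \<odot> g) (\<rho> g t))
         (pscale (dom g) fun_ob d (Q' (f \<odot> g) (\<rho> g t)))))"

definition dot ::
  "'o \<Rightarrow> ('m \<Rightarrow> 'r \<Rightarrow> 'm \<Rightarrow> ('m \<Rightarrow> 'r \<Rightarrow> 'r) \<Rightarrow> 'r) \<Rightarrow>
    'm \<Rightarrow> 'r \<Rightarrow> 'm \<Rightarrow> ('m \<Rightarrow> 'r \<Rightarrow> 'r) \<Rightarrow> 'r" where
  "dot X Q = the_el X evol_ob (is_dot X Q)"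

definition wave_solution :: "'o \<Rightarrow> ('m \<Rightarrow> 'r \<Rightarrow> 'm \<Rightarrow> ('m \<Rightarrow> 'r \<Rightarrow> 'r) \<Rightarrow> 'r) \<Rightarrow> bool" where
  "wave_solution X Q \<longleftrightarrow>
     Q \<in> El evol_ob X \<and>
     kj_all X line (\<lambda>f t. dot X (dot X Q) f t = Laplace (dom f) (Q f t))"

definition initial_value ::
  "'o \<Rightarrow> ('m \<Rightarrow> 'r \<Rightarrow> 'm \<Rightarrow> ('m \<Rightarrow> 'r \<Rightarrow> 'r) \<Rightarrow> 'r) \<Rightarrow> 'm \<Rightarrow> ('m \<Rightarrow> 'r \<Rightarrow> 'r) \<Rightarrow> 'r" where
  "initial_value X Q = Q (ide X) \<zero>\<^bsub>RR X\<^esub>"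

definition initial_speed ::
  "'o \<Rightarrow> ('m \<Rightarrow> 'r \<Rightarrow> 'm \<Rightarrow> ('m \<Rightarrow> 'r \<Rightarrow> 'r) \<Rightarrow> 'r) \<Rightarrow> 'm \<Rightarrow> ('m \<Rightarrow> 'r \<Rightarrow> 'r) \<Rightarrow> 'r" where
  "initial_speed X Q = dot X Q (ide X) \<zero>\<^bsub>RR X\<^esub>"

subsection \<open>Spheres and balls in dimension 1\<close>

definition sphere1 :: "'o \<Rightarrow> 'r \<Rightarrow> 'm \<Rightarrow> ('m \<Rightarrow> 'r \<Rightarrow> 'r) \<Rightarrow> 'r" where
  "sphere1 X t = lam X fun_ob (\<lambda>f \<psi>.
     \<psi> (ide (dom f)) (\<ominus>\<^bsub>RR (dom f)\<^esub> \<rho> f t) \<oplus>\<^bsub>RR (dom f)\<^esub> \<psi> (ide (dom f)) (\<rho> f t))"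

definition ball1 :: "'o \<Rightarrow> 'r \<Rightarrow> 'm \<Rightarrow> ('m \<Rightarrow> 'r \<Rightarrow> 'r) \<Rightarrow> 'r" where
  "ball1 X t = lam X fun_ob (\<lambda>f \<psi>.
     integral (dom f) (\<ominus>\<^bsub>RR (dom f)\<^esub> \<rho> f t) (\<rho> f t) \<psi>)"

definition half :: "'o \<Rightarrow> ('m \<Rightarrow> ('m \<Rightarrow> 'r \<Rightarrow> 'r) \<Rightarrow> 'r) \<Rightarrow> 'm \<Rightarrow> ('m \<Rightarrow> 'r \<Rightarrow> 'r) \<Rightarrow> 'r" where
  "half X \<mu> = pscale X fun_ob (of_q L X (1 / 2)) \<mu>"

definition half_sphere :: "'o \<Rightarrow> 'm \<Rightarrow> 'r \<Rightarrow> 'm \<Rightarrow> ('m \<Rightarrow> 'r \<Rightarrow> 'r) \<Rightarrow> 'r" where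
  "half_sphere X = lam X line (\<lambda>f t. half (dom f) (sphere1 (dom f) t))"

definition half_ball :: "'o \<Rightarrow> 'm \<Rightarrow> 'r \<Rightarrow> 'm \<Rightarrow> ('m \<Rightarrow> 'r \<Rightarrow> 'r) \<Rightarrow> 'r" where
  "half_ball X = lam X line (\<lambda>f t. half (dom f) (ball1 (dom f) t))"

end

locale sdg_model = ring_object +
  assumes Q_ring: is_Q_ring
    and Kock_Lawvere: Kock_Lawvere
    and integration: integration_axiom

end

theory Submission
  imports Defs
begin

text \<open>
  Write \<open>A\<^sub>t(\<psi>) = 1/2 (\<psi>(-t) + \<psi>(t))\<close> and \<open>O\<^sub>t(\<psi>) = 1/2 (\<psi>(t) - \<psi>(-t))\<close> for the even and the
  odd part of a test function at \<open>t\<close>. Expanding \<open>\<psi>\<close> to first order at \<open>t\<close> and at \<open>-t\<close> gives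
  \<open>d/dt A\<^sub>t(\<psi>) = O\<^sub>t(\<psi>')\<close> and \<open>d/dt O\<^sub>t(\<psi>) = A\<^sub>t(\<psi>')\<close> (\<open>even_odd_increment\<close>). The half sphere is \<open>A\<^sub>t\<close>,
  so its second time derivative at \<open>\<psi>\<close> is \<open>A\<^sub>t(\<psi>'')\<close>. The half ball is \<open>O\<^sub>t\<close> composed with the
  antiderivative vanishing at \<open>0\<close>; its time derivative at \<open>\<psi>\<close> is therefore \<open>A\<^sub>t(\<psi>)\<close>, and its second
  time derivative is \<open>O\<^sub>t(\<psi>')\<close>. The latter is the value of the half ball at \<open>\<psi>''\<close>, because \<open>\<psi>'\<close> and the
  chosen antiderivative of \<open>\<psi>''\<close> have the same increments (\<open>odd_part_antideriv_deriv\<close>). Putting \<open>t = 0\<close>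
  gives the initial data: \<open>A\<^sub>0\<close> is evaluation at \<open>0\<close> and \<open>O\<^sub>0\<close> vanishes.

  The remaining work is to make sense of derivatives, integrals and time derivatives at a given stage.
  They are definite descriptions, so global existence and uniqueness have to be extracted from the
  forced statements. Forced unique existence in a sheaf yields a unique global element
  (\<open>kj_ex1_global\<close>); the sheaves that occur are the square of the line and its function object
  (\<open>prod_sheaf\<close>, \<open>expo_sheaf\<close>). Applied to the Kock--Lawvere axiom this gives derivatives (\<open>deriv_exists\<close>) and the cancellation of
  universally quantified infinitesimals (\<open>microcancellation\<close>), which makes derivatives of functions and
  of evolving distributions unique (\<open>deriv_unique\<close>, \<open>is_dot_unique\<close>). Applied to the integration axiom
  it gives antiderivatives and the fundamental theorem (\<open>integral_eq\<close>).

  Every evolving distribution in the argument comes from a family of functionals that is given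
  uniformly at all stages. For such families the time derivative can be read off from increments
  (\<open>dot_evolution\<close>), which reduces the wave equation to the two formulas above
  (\<open>wave_solution_evolution\<close>).
\<close>

section \<open>Gluing in sheaves and exponentials\<close>

context grothendieck_site
begin

lemma presheaf_closed: "is_presheaf A \<Longrightarrow> a \<in> El A (cod f) \<Longrightarrow> Res A f a \<in> El A (dom f)"
  by (simp add: is_presheaf_def)

lemma presheaf_ide: "is_presheaf A \<Longrightarrow> a \<in> El A X \<Longrightarrow> Res A (ide X) a = a"
  by (simp add: is_presheaf_def)

lemma presheaf_comp:
  "is_presheaf A \<Longrightarrow> cod g = dom f \<Longrightarrow> a \<in> El A (cod f) \<Longrightarrow> Res A (f \<odot> g) a = Res A g (Res A f a)"
  by (simp add: is_presheaf_def)

lemma sheaf_presheaf: "is_sheaf A \<Longrightarrow> is_presheaf A"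
  by (simp add: is_sheaf_def)

lemma cover_cod: "S \<in> Cov C X \<Longrightarrow> f \<in> S \<Longrightarrow> cod f = X"
  using Cov_sieve[of S X] by (simp add: sieve_on_def)

lemma cover_comp: "S \<in> Cov C X \<Longrightarrow> f \<in> S \<Longrightarrow> cod g = dom f \<Longrightarrow> f \<odot> g \<in> S"
  using Cov_sieve[of S X] by (simp add: sieve_on_def)

lemma sheaf_glue:
  assumes "is_sheaf A" "S \<in> Cov C X"
    and "\<And>f. f \<in> S \<Longrightarrow> fam f \<in> El A (dom f)"
    and "\<And>f g. f \<in> S \<Longrightarrow> cod g = dom f \<Longrightarrow> fam (f \<odot> g) = Res A g (fam f)"
  shows "\<exists>!a. a \<in> El A X \<and> (\<forall>f\<in>S. Res A f a = fam f)"
proof -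
  have "(\<forall>f\<in>S. fam f \<in> El A (dom f)) \<and>
      (\<forall>f\<in>S. \<forall>g. cod g = dom f \<longrightarrow> fam (f \<odot> g) = Res A g (fam f))"
    using assms(3,4) by simp
  moreover have "(\<forall>f\<in>S. fam f \<in> El A (dom f)) \<and>
      (\<forall>f\<in>S. \<forall>g. cod g = dom f \<longrightarrow> fam (f \<odot> g) = Res A g (fam f))
      \<longrightarrow> (\<exists>!a. a \<in> El A X \<and> (\<forall>f\<in>S. Res A f a = fam f))"
    using assms(1,2) unfolding is_sheaf_def by (elim conjE allE[of _ X] ballE[of _ _ S] allE[of _ fam]) simp_all
  ultimately show ?thesis by (rule rev_mp)
qed

lemma sheaf_separated:
  assumes A: "is_sheaf A" and S: "S \<in> Cov C X"
    and a: "a \<in> El A X" and b: "b \<in> El A X"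
    and eq: "\<And>f. f \<in> S \<Longrightarrow> Res A f a = Res A f b"
  shows "a = b"
proof -
  note P = sheaf_presheaf[OF A]
  have "\<exists>!c. c \<in> El A X \<and> (\<forall>f\<in>S. Res A f c = Res A f a)"
    using a cover_cod[OF S]
    by (intro sheaf_glue[OF A S]) (auto simp: presheaf_closed[OF P] presheaf_comp[OF P])
  then obtain c where c: "\<And>c'. c' \<in> El A X \<and> (\<forall>f\<in>S. Res A f c' = Res A f a) \<Longrightarrow> c' = c"
    by (rule ex1E) blast
  have "a = c" using a by (intro c) simp
  moreover have "b = c" using b eq by (intro c) simp
  ultimately show ?thesis by simp
qed

text \<open>
  Witnesses of a forced unique existence are only local. Forced uniqueness makes them agree on
  overlaps, so in a sheaf they glue; locality of the property carries it over to the glued element.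
\<close>

lemma kj_ex1_global:
  assumes A: "is_sheaf A" and ex1: "kj_ex1 X A \<phi>"
    and stable: "\<And>f a. cod f = X \<Longrightarrow> a \<in> El A X \<Longrightarrow> \<phi> (ide X) a \<Longrightarrow> \<phi> f (Res A f a)"
    and local: "\<And>S a. S \<in> Cov C X \<Longrightarrow> a \<in> El A X \<Longrightarrow> (\<And>f. f \<in> S \<Longrightarrow> \<phi> f (Res A f a))
      \<Longrightarrow> \<phi> (ide X) a"
  shows "\<exists>!a. a \<in> El A X \<and> \<phi> (ide X) a"
proof -
  note P = sheaf_presheaf[OF A]
  from ex1 obtain S where S: "S \<in> Cov C X"
    and witness: "\<forall>f\<in>S. \<exists>a\<in>El A (dom f). \<phi> f a \<and> kj_all (dom f) A (\<lambda>g b.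
         kj_imp (dom g) (\<lambda>h. \<phi> (f \<odot> g \<odot> h) (Res A h b))
                        (\<lambda>h. Res A h b = Res A (g \<odot> h) a))"
    unfolding kj_ex1_def kj_ex_def by blast
  from bchoice[OF witness[unfolded Bex_def]]
  obtain w where w: "\<And>f. f \<in> S \<Longrightarrow> w f \<in> El A (dom f)" "\<And>f. f \<in> S \<Longrightarrow> \<phi> f (w f)"
    and w_all: "\<And>f. f \<in> S \<Longrightarrow> kj_all (dom f) A (\<lambda>g b.
         kj_imp (dom g) (\<lambda>h. \<phi> (f \<odot> g \<odot> h) (Res A h b))
                        (\<lambda>h. Res A h b = Res A (g \<odot> h) (w f)))"
    by blast
  \<comment> \<open>Instantiating the innermost arrow with the identity turns forced uniqueness into equality.\<close>
  have w_unique: "b = Res A g (w f)"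
    if "f \<in> S" "cod g = dom f" "b \<in> El A (dom g)" "\<phi> (f \<odot> g) b" for f g b
  proof -
    have "cod (ide (dom g)) = dom g \<longrightarrow> \<phi> (f \<odot> g \<odot> ide (dom g)) (Res A (ide (dom g)) b)
        \<longrightarrow> Res A (ide (dom g)) b = Res A (g \<odot> ide (dom g)) (w f)"
      using w_all[OF that(1)] that unfolding kj_all_def kj_imp_def by blast
    moreover have "f \<odot> g \<odot> ide (dom g) = f \<odot> g"
      using Comp_Ident[of "f \<odot> g"] that by (simp add: Dom_Comp)
    ultimately show ?thesis using that by (simp add: Cod_Ident presheaf_ide[OF P] Comp_Ident)
  qed
  have "\<exists>!a. a \<in> El A X \<and> (\<forall>f\<in>S. Res A f a = w f)"
  proof (rule sheaf_glue[OF A S])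
    fix f g assume fg: "f \<in> S" "cod g = dom f"
    then show "w (f \<odot> g) = Res A g (w f)"
      using w[of "f \<odot> g"] cover_comp[OF S fg] by (intro w_unique) (simp_all add: Dom_Comp)
  qed (use w in simp)
  then obtain a where a: "a \<in> El A X" "\<And>f. f \<in> S \<Longrightarrow> Res A f a = w f" by blast
  show ?thesis
  proof (rule ex1I[of _ a])
    show "a \<in> El A X \<and> \<phi> (ide X) a" using local[OF S a(1)] a w by simp
  next
    fix b assume b: "b \<in> El A X \<and> \<phi> (ide X) b"
    show "b = a"
    proof (rule sheaf_separated[OF A S])
      fix f assume f: "f \<in> S"
      have c: "cod f = X" using cover_cod[OF S f] .
      have "Res A f b = Res A (ide (dom f)) (w f)"
        using b c stable[OF c] f presheaf_closed[OF P, of b f]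
        by (intro w_unique) (simp_all add: Cod_Ident Dom_Ident Comp_Ident)
      then show "Res A f b = Res A f a" using a w f by (simp add: presheaf_ide[OF P])
    qed (use a b in auto)
  qed
qed

lemma prod_sheaf:
  assumes A: "is_sheaf A" and B: "is_sheaf B"
  shows "is_sheaf (prod_ob A B)"
proof -
  note P = sheaf_presheaf[OF A] sheaf_presheaf[OF B]
  show ?thesis
    unfolding is_sheaf_def
  proof (intro conjI allI ballI impI, goal_cases)
    case 1
    show ?case
      using presheaf_closed[OF P(1)] presheaf_closed[OF P(2)] presheaf_ide[OF P(1)]
        presheaf_ide[OF P(2)] presheaf_comp[OF P(1)] presheaf_comp[OF P(2)]
      by (simp add: is_presheaf_def prod_ob_def)
  next
    case (2 X S fam)
    have f: "fst (fam f) \<in> El A (dom f)" "snd (fam f) \<in> El B (dom f)" if "f \<in> S" for f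
      using 2 that by (auto simp: prod_ob_def mem_Times_iff)
    have n: "fst (fam (f \<odot> g)) = Res A g (fst (fam f))" "snd (fam (f \<odot> g)) = Res B g (snd (fam f))"
      if "f \<in> S" "cod g = dom f" for f g
      using 2 that by (auto simp: prod_ob_def)
    have "\<exists>!a. a \<in> El A X \<and> (\<forall>f\<in>S. Res A f a = fst (fam f))"
      by (rule sheaf_glue[OF A]) (use f n 2(1) in simp_all)
    then obtain a where a: "a \<in> El A X" "\<forall>f\<in>S. Res A f a = fst (fam f)"
      "\<And>a'. a' \<in> El A X \<Longrightarrow> \<forall>f\<in>S. Res A f a' = fst (fam f) \<Longrightarrow> a' = a"
      by (rule ex1E) blast
    have "\<exists>!b. b \<in> El B X \<and> (\<forall>f\<in>S. Res B f b = snd (fam f))"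
      by (rule sheaf_glue[OF B]) (use f n 2(1) in simp_all)
    then obtain b where b: "b \<in> El B X" "\<forall>f\<in>S. Res B f b = snd (fam f)"
      "\<And>b'. b' \<in> El B X \<Longrightarrow> \<forall>f\<in>S. Res B f b' = snd (fam f) \<Longrightarrow> b' = b"
      by (rule ex1E) blast
    show ?case
    proof (rule ex1I[of _ "(a, b)"])
      show "(a, b) \<in> El (prod_ob A B) X \<and> (\<forall>f\<in>S. Res (prod_ob A B) f (a, b) = fam f)"
        using a(1,2) b(1,2) by (simp add: prod_ob_def)
      fix c assume "c \<in> El (prod_ob A B) X \<and> (\<forall>f\<in>S. Res (prod_ob A B) f c = fam f)"
      then have c: "fst c \<in> El A X" "snd c \<in> El B X" "\<forall>f\<in>S. fam f = map_prod (Res A f) (Res B f) c"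
        by (auto simp: prod_ob_def)
      then have "fst c = a" "snd c = b" by (auto intro!: a(3) b(3))
      then show "c = (a, b)" by (simp add: prod_eq_iff)
    qed
  qed
qed

lemma lam_apply: "cod f = X \<Longrightarrow> a \<in> El A (dom f) \<Longrightarrow> lam X A F f a = F f a"
  by (simp add: lam_def)

lemma lam_cong:
  assumes "\<And>f a. cod f = X \<Longrightarrow> a \<in> El A (dom f) \<Longrightarrow> F f a = G f a"
  shows "lam X A F = lam X A G"
  using assms by (auto simp: lam_def fun_eq_iff)

lemma expo_closed:
  "\<theta> \<in> El (expo A B) X \<Longrightarrow> cod f = X \<Longrightarrow> a \<in> El A (dom f) \<Longrightarrow> \<theta> f a \<in> El B (dom f)"
  by (simp add: expo_def)

lemma expo_natural:
  "\<theta> \<in> El (expo A B) X \<Longrightarrow> cod f = X \<Longrightarrow> cod g = dom f \<Longrightarrow> a \<in> El A (dom f) \<Longrightarrow>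
    \<theta> (f \<odot> g) (Res A g a) = Res B g (\<theta> f a)"
  by (simp add: expo_def)

lemma expo_ext:
  assumes "\<theta> \<in> El (expo A B) X" "\<eta> \<in> El (expo A B) X"
    and "\<And>f a. cod f = X \<Longrightarrow> a \<in> El A (dom f) \<Longrightarrow> \<theta> f a = \<eta> f a"
  shows "\<theta> = \<eta>"
proof (intro ext)
  fix f a
  show "\<theta> f a = \<eta> f a"
    using assms by (cases "cod f = X \<and> a \<in> El A (dom f)") (auto simp: expo_def)
qed

lemma lam_in_expo:
  assumes A: "is_presheaf A"
    and "\<And>f a. cod f = X \<Longrightarrow> a \<in> El A (dom f) \<Longrightarrow> F f a \<in> El B (dom f)"
    and "\<And>f g a. cod f = X \<Longrightarrow> cod g = dom f \<Longrightarrow> a \<in> El A (dom f) \<Longrightarrow>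
      F (f \<odot> g) (Res A g a) = Res B g (F f a)"
  shows "lam X A F \<in> El (expo A B) X"
  using assms(2,3) presheaf_closed[OF A]
  by (auto simp: expo_def lam_def Cod_Comp Dom_Comp)

lemma Res_expo: "Res (expo A B) h \<theta> = lam (dom h) A (\<lambda>f. \<theta> (h \<odot> f))"
  by (simp add: expo_def)

lemma Res_expo_apply:
  "cod f = dom h \<Longrightarrow> a \<in> El A (dom f) \<Longrightarrow> Res (expo A B) h \<theta> f a = \<theta> (h \<odot> f) a"
  by (simp add: Res_expo lam_apply)

lemma expo_presheaf:
  assumes A: "is_presheaf A"
  shows "is_presheaf (expo A B)"
  unfolding is_presheaf_def
proof (intro conjI allI ballI impI)
  fix f \<theta> assume \<theta>: "\<theta> \<in> El (expo A B) (cod f)"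
  show "Res (expo A B) f \<theta> \<in> El (expo A B) (dom f)"
    unfolding Res_expo
    using expo_closed[OF \<theta>] expo_natural[OF \<theta>]
    by (intro lam_in_expo[OF A]) (metis Cod_Comp Dom_Comp Comp_assoc)+
next
  fix X \<theta> assume \<theta>: "\<theta> \<in> El (expo A B) X"
  have "ide X \<odot> f = f" if "cod f = X" for f using Ident_Comp[of f] that by simp
  then show "Res (expo A B) (ide X) \<theta> = \<theta>"
    using \<theta> by (auto simp: Res_expo lam_def expo_def Dom_Ident fun_eq_iff)
next
  fix f g \<theta> assume "cod g = dom f" "\<theta> \<in> El (expo A B) (cod f)"
  then show "Res (expo A B) (f \<odot> g) \<theta> = Res (expo A B) g (Res (expo A B) f \<theta>)"
    by (auto simp: Res_expo lam_def Dom_Comp Cod_Comp Comp_assoc fun_eq_iff)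
qed

text \<open>
  To glue transformations \<open>fam f\<close> indexed by a cover of \<open>X\<close>, let the value of the glued
  transformation at \<open>h\<close> and \<open>a\<close> be the amalgamation in \<open>B\<close>, along the cover pulled back to the domain
  of \<open>h\<close>, of the values of the members of the family at the restrictions of \<open>a\<close>.
\<close>

lemma expo_sheaf:
  assumes A: "is_presheaf A" and B: "is_sheaf B"
  shows "is_sheaf (expo A B)"
  unfolding is_sheaf_def
proof (intro conjI allI ballI impI expo_presheaf[OF A], goal_cases)
  case (1 X S fam)
  then have S: "S \<in> Cov C X"
    and fam: "\<And>f. f \<in> S \<Longrightarrow> fam f \<in> El (expo A B) (dom f)"
    and match: "\<And>f g. f \<in> S \<Longrightarrow> cod g = dom f \<Longrightarrow> fam (f \<odot> g) = Res (expo A B) g (fam f)"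
    by auto
  note PB = sheaf_presheaf[OF B]
  let ?P = "\<lambda>h a b. b \<in> El B (dom h) \<and>
    (\<forall>g\<in>pull_sieve C h S. Res B g b = fam (h \<odot> g) (ide (dom g)) (Res A g a))"
  have pull: "pull_sieve C h S \<in> Cov C (dom h)" if "cod h = X" for h
    using Cov_stable S that by blast
  have fam_comp: "fam (f \<odot> k) (ide (dom k)) a = fam f k a"
    if "f \<in> S" "cod k = dom f" "a \<in> El A (dom k)" for f k a
    using that by (simp add: match Res_expo_apply Cod_Ident Dom_Ident Comp_Ident)
  have ex1: "\<exists>!b. ?P h a b" if h: "cod h = X" and a: "a \<in> El A (dom h)" for h a
  proof (rule sheaf_glue[OF B pull[OF h]])
    fix g assume g: "g \<in> pull_sieve C h S"
    then show "fam (h \<odot> g) (ide (dom g)) (Res A g a) \<in> El B (dom g)"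
      using expo_closed[OF fam, of "h \<odot> g" "ide (dom g)" "Res A g a"] presheaf_closed[OF A, of a g] a
      by (auto simp: pull_sieve_def Dom_Comp Cod_Ident Dom_Ident)
    fix k assume k: "cod k = dom g"
    have m: "h \<odot> g \<in> S" "cod g = dom h" using g by (auto simp: pull_sieve_def)
    have a': "Res A g a \<in> El A (dom g)" using presheaf_closed[OF A, of a g] a m by simp
    have "fam (h \<odot> (g \<odot> k)) (ide (dom (g \<odot> k))) (Res A (g \<odot> k) a)
        = fam (h \<odot> g \<odot> k) (ide (dom k)) (Res A k (Res A g a))"
      using k m a by (simp add: Dom_Comp Comp_assoc presheaf_comp[OF A])
    also have "\<dots> = fam (h \<odot> g) k (Res A k (Res A g a))"
      using k m a' presheaf_closed[OF A, of "Res A g a" k] by (intro fam_comp) (simp_all add: Dom_Comp)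
    also have "\<dots> = fam (h \<odot> g) (ide (dom g) \<odot> k) (Res A k (Res A g a))"
      using Ident_Comp[of k] k by simp
    also have "\<dots> = Res B k (fam (h \<odot> g) (ide (dom g)) (Res A g a))"
      using k m a' by (intro expo_natural[OF fam]) (simp_all add: Dom_Comp Cod_Ident Dom_Ident)
    finally show "fam (h \<odot> (g \<odot> k)) (ide (dom (g \<odot> k))) (Res A (g \<odot> k) a)
        = Res B k (fam (h \<odot> g) (ide (dom g)) (Res A g a))" .
  qed
  define \<theta> where "\<theta> = lam X A (\<lambda>h a. THE b. ?P h a b)"
  have \<theta>: "?P h a (\<theta> h a)" if "cod h = X" "a \<in> El A (dom h)" for h a
    using theI'[OF ex1[OF that]] that by (simp add: \<theta>_def lam_apply)
  have \<theta>_unique: "b = \<theta> h a" if "cod h = X" "a \<in> El A (dom h)" "?P h a b" for h a b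
    using ex1[OF that(1,2)] \<theta>[OF that(1,2)] that(3) by blast
  have \<theta>_fam: "\<theta> f a = fam f (ide (dom f)) a" if f: "f \<in> S" and a: "a \<in> El A (dom f)" for f a
  proof (rule \<theta>_unique[symmetric])
    show "cod f = X" using cover_cod[OF S f] .
    show "a \<in> El A (dom f)" by fact
    have "fam (f \<odot> g) (ide (dom g)) (Res A g a) = Res B g (fam f (ide (dom f)) a)"
      if g: "cod g = dom f" for g
    proof -
      have "fam (f \<odot> g) (ide (dom g)) (Res A g a) = fam f (ide (dom f) \<odot> g) (Res A g a)"
        using fam_comp[OF f g] presheaf_closed[OF A, of a g] a g Ident_Comp[of g] by simp
      also have "\<dots> = Res B g (fam f (ide (dom f)) a)"
        using a g by (intro expo_natural[OF fam[OF f]]) (simp_all add: Cod_Ident Dom_Ident)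
      finally show ?thesis .
    qed
    then show "?P f a (fam f (ide (dom f)) a)"
      using expo_closed[OF fam[OF f], of "ide (dom f)" a] a
      by (auto simp: pull_sieve_def Cod_Ident Dom_Ident)
  qed
  have in_expo: "\<theta> \<in> El (expo A B) X"
    unfolding \<theta>_def
  proof (rule lam_in_expo[OF A])
    fix h a assume "cod h = X" "a \<in> El A (dom h)"
    then show "(THE b. ?P h a b) \<in> El B (dom h)" using theI'[OF ex1] by blast
  next
    fix h k a assume h: "cod h = X" and k: "cod k = dom h" and a: "a \<in> El A (dom h)"
    have hk: "cod (h \<odot> k) = X" "Res A k a \<in> El A (dom (h \<odot> k))"
      using h k a presheaf_closed[OF A, of a k] by (simp_all add: Cod_Comp Dom_Comp)
    have "?P (h \<odot> k) (Res A k a) (Res B k (\<theta> h a))"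
    proof (intro conjI ballI)
      show "Res B k (\<theta> h a) \<in> El B (dom (h \<odot> k))"
        using \<theta>[OF h a] k presheaf_closed[OF PB, of "\<theta> h a" k] by (simp add: Dom_Comp)
    next
      fix g assume "g \<in> pull_sieve C (h \<odot> k) S"
      then have g: "cod g = dom k" "h \<odot> (k \<odot> g) \<in> S"
        using h k by (auto simp: pull_sieve_def Dom_Comp Comp_assoc)
      then have "k \<odot> g \<in> pull_sieve C h S" using k by (simp add: pull_sieve_def Cod_Comp)
      then have "Res B (k \<odot> g) (\<theta> h a) = fam (h \<odot> (k \<odot> g)) (ide (dom (k \<odot> g))) (Res A (k \<odot> g) a)"
        using \<theta>[OF h a] by blast
      then show "Res B g (Res B k (\<theta> h a))
          = fam (h \<odot> k \<odot> g) (ide (dom g)) (Res A g (Res A k a))"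
        using g h k a \<theta>[OF h a]
        by (simp add: presheaf_comp[OF A] presheaf_comp[OF PB] Dom_Comp Comp_assoc)
    qed
    then show "(THE b. ?P (h \<odot> k) (Res A k a) b) = Res B k (THE b. ?P h a b)"
      using \<theta>_unique[OF hk] hk h a by (simp add: \<theta>_def lam_apply)
  qed
  show ?case
  proof (rule ex1I[of _ \<theta>])
    show "\<theta> \<in> El (expo A B) X \<and> (\<forall>f\<in>S. Res (expo A B) f \<theta> = fam f)"
    proof (intro conjI ballI in_expo)
      fix f assume f: "f \<in> S"
      show "Res (expo A B) f \<theta> = fam f"
      proof (rule expo_ext[OF _ fam[OF f]])
        show "Res (expo A B) f \<theta> \<in> El (expo A B) (dom f)"
          using presheaf_closed[OF expo_presheaf[OF A], of \<theta> B f] in_expo cover_cod[OF S f] by simp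
        fix k a assume k: "cod k = dom f" "a \<in> El A (dom k)"
        then have "\<theta> (f \<odot> k) a = fam f k a"
          using \<theta>_fam[of "f \<odot> k" a] cover_comp[OF S f k(1)] fam_comp[OF f k] by (simp add: Dom_Comp)
        then show "Res (expo A B) f \<theta> k a = fam f k a" using k by (simp add: Res_expo_apply)
      qed
    qed
  next
    fix \<eta> assume \<eta>: "\<eta> \<in> El (expo A B) X \<and> (\<forall>f\<in>S. Res (expo A B) f \<eta> = fam f)"
    show "\<eta> = \<theta>"
    proof (rule expo_ext[OF _ in_expo])
      fix h a assume h: "cod h = X" and a: "a \<in> El A (dom h)"
      show "\<eta> h a = \<theta> h a"
      proof (rule \<theta>_unique[OF h a], intro conjI ballI)
        show "\<eta> h a \<in> El B (dom h)" using \<eta> h a by (auto intro: expo_closed[of \<eta> A B X])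
        fix g assume "g \<in> pull_sieve C h S"
        then have g: "cod g = dom h" "h \<odot> g \<in> S" by (auto simp: pull_sieve_def)
        have ga: "Res A g a \<in> El A (dom g)" using presheaf_closed[OF A, of a g] g a by simp
        have "fam (h \<odot> g) (ide (dom g)) (Res A g a) = Res (expo A B) (h \<odot> g) \<eta> (ide (dom g)) (Res A g a)"
          using \<eta> g by simp
        also have "\<dots> = \<eta> (h \<odot> g) (Res A g a)"
          using g ga Comp_Ident[of "h \<odot> g"] by (simp add: Res_expo_apply Dom_Comp Cod_Ident Dom_Ident)
        also have "\<dots> = Res B g (\<eta> h a)" using \<eta> h g a by (auto intro: expo_natural[of \<eta> A B X])
        finally show "Res B g (\<eta> h a) = fam (h \<odot> g) (ide (dom g)) (Res A g a)" ..
      qed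
    qed (use \<eta> in auto)
  qed
qed

end


section \<open>The Kock--Lawvere axiom\<close>

context sdg_model
begin

lemma El_line [simp]: "El line X = carrier (RR X)"
  and Res_line [simp]: "Res line f = \<rho> f"
  by (simp_all add: line_def)

lemma El_infin: "El infin X = {d \<in> carrier (RR X). d \<otimes>\<^bsub>RR X\<^esub> d = \<zero>\<^bsub>RR X\<^esub>}"
  and Res_infin [simp]: "Res infin f = \<rho> f"
  by (simp_all add: infin_def subob_def)

lemma line_sheaf: "is_sheaf line"
  and line_cring: "cring (RR X)"
  and \<rho>_hom: "\<rho> f \<in> ring_hom (RR (cod f)) (RR (dom f))"
  and of_q_hom: "of_q L X \<in> ring_hom rat_ring (RR X)"
  and \<rho>_of_q: "\<rho> f (of_q L (cod f) q) = of_q L (dom f) q"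
  using Q_ring by (simp_all add: is_Q_ring_def)

lemma line_presheaf: "is_presheaf line"
  using line_sheaf by (rule sheaf_presheaf)

lemma \<rho>_closed [simp]: "cod f = X \<Longrightarrow> x \<in> carrier (RR X) \<Longrightarrow> \<rho> f x \<in> carrier (RR (dom f))"
  using presheaf_closed[OF line_presheaf, of x f] by simp

lemma \<rho>_ide [simp]: "x \<in> carrier (RR X) \<Longrightarrow> \<rho> (ide X) x = x"
  using presheaf_ide[OF line_presheaf, of x X] by simp

lemma \<rho>_comp:
  "cod f = X \<Longrightarrow> cod g = dom f \<Longrightarrow> x \<in> carrier (RR X) \<Longrightarrow> \<rho> (f \<odot> g) x = \<rho> g (\<rho> f x)"
  using presheaf_comp[OF line_presheaf, of g f x] by simp

lemma \<rho>_ring: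
  assumes "cod f = X"
  shows "x \<in> carrier (RR X) \<Longrightarrow> y \<in> carrier (RR X) \<Longrightarrow>
      \<rho> f (x \<oplus>\<^bsub>RR X\<^esub> y) = \<rho> f x \<oplus>\<^bsub>RR (dom f)\<^esub> \<rho> f y"
    and "x \<in> carrier (RR X) \<Longrightarrow> y \<in> carrier (RR X) \<Longrightarrow>
      \<rho> f (x \<otimes>\<^bsub>RR X\<^esub> y) = \<rho> f x \<otimes>\<^bsub>RR (dom f)\<^esub> \<rho> f y"
    and "\<rho> f \<zero>\<^bsub>RR X\<^esub> = \<zero>\<^bsub>RR (dom f)\<^esub>"
    and "x \<in> carrier (RR X) \<Longrightarrow> \<rho> f (\<ominus>\<^bsub>RR X\<^esub> x) = \<ominus>\<^bsub>RR (dom f)\<^esub> \<rho> f x"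
    and "x \<in> carrier (RR X) \<Longrightarrow> y \<in> carrier (RR X) \<Longrightarrow>
      \<rho> f (x \<ominus>\<^bsub>RR X\<^esub> y) = \<rho> f x \<ominus>\<^bsub>RR (dom f)\<^esub> \<rho> f y"
proof -
  interpret ring_hom_cring "RR X" "RR (dom f)" "\<rho> f"
    using line_cring \<rho>_hom[of f] assms by (auto simp: ring_hom_cring_def ring_hom_cring_axioms_def)
  show "x \<in> carrier (RR X) \<Longrightarrow> y \<in> carrier (RR X) \<Longrightarrow>
      \<rho> f (x \<oplus>\<^bsub>RR X\<^esub> y) = \<rho> f x \<oplus>\<^bsub>RR (dom f)\<^esub> \<rho> f y"
    "x \<in> carrier (RR X) \<Longrightarrow> y \<in> carrier (RR X) \<Longrightarrow>
      \<rho> f (x \<otimes>\<^bsub>RR X\<^esub> y) = \<rho> f x \<otimes>\<^bsub>RR (dom f)\<^esub> \<rho> f y"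
    "\<rho> f \<zero>\<^bsub>RR X\<^esub> = \<zero>\<^bsub>RR (dom f)\<^esub>"
    "x \<in> carrier (RR X) \<Longrightarrow> \<rho> f (\<ominus>\<^bsub>RR X\<^esub> x) = \<ominus>\<^bsub>RR (dom f)\<^esub> \<rho> f x"
    "x \<in> carrier (RR X) \<Longrightarrow> y \<in> carrier (RR X) \<Longrightarrow>
      \<rho> f (x \<ominus>\<^bsub>RR X\<^esub> y) = \<rho> f x \<ominus>\<^bsub>RR (dom f)\<^esub> \<rho> f y"
    by (simp_all add: a_minus_def)
qed

lemma ring_closed [simp]:
  "\<zero>\<^bsub>RR X\<^esub> \<in> carrier (RR X)"
  "x \<in> carrier (RR X) \<Longrightarrow> \<ominus>\<^bsub>RR X\<^esub> x \<in> carrier (RR X)"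
  "x \<in> carrier (RR X) \<Longrightarrow> y \<in> carrier (RR X) \<Longrightarrow> x \<oplus>\<^bsub>RR X\<^esub> y \<in> carrier (RR X)"
  "x \<in> carrier (RR X) \<Longrightarrow> y \<in> carrier (RR X) \<Longrightarrow> x \<otimes>\<^bsub>RR X\<^esub> y \<in> carrier (RR X)"
  "x \<in> carrier (RR X) \<Longrightarrow> y \<in> carrier (RR X) \<Longrightarrow> x \<ominus>\<^bsub>RR X\<^esub> y \<in> carrier (RR X)"
proof -
  interpret cring "RR X" by (rule line_cring)
  show "\<zero>\<^bsub>RR X\<^esub> \<in> carrier (RR X)"
    "x \<in> carrier (RR X) \<Longrightarrow> \<ominus>\<^bsub>RR X\<^esub> x \<in> carrier (RR X)"
    "x \<in> carrier (RR X) \<Longrightarrow> y \<in> carrier (RR X) \<Longrightarrow> x \<oplus>\<^bsub>RR X\<^esub> y \<in> carrier (RR X)"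
    "x \<in> carrier (RR X) \<Longrightarrow> y \<in> carrier (RR X) \<Longrightarrow> x \<otimes>\<^bsub>RR X\<^esub> y \<in> carrier (RR X)"
    "x \<in> carrier (RR X) \<Longrightarrow> y \<in> carrier (RR X) \<Longrightarrow> x \<ominus>\<^bsub>RR X\<^esub> y \<in> carrier (RR X)"
    by simp_all
qed

lemma of_q_closed [simp]: "of_q L X q \<in> carrier (RR X)"
  using of_q_hom[of X] by (auto simp: ring_hom_def rat_ring_def)

lemma half_double:
  assumes x: "x \<in> carrier (RR X)"
  shows "of_q L X (1 / 2) \<otimes>\<^bsub>RR X\<^esub> (x \<oplus>\<^bsub>RR X\<^esub> x) = x"
proof -
  interpret cring "RR X" by (rule line_cring)
  have "of_q L X (1 / 2 + 1 / 2) = of_q L X (1 / 2) \<oplus>\<^bsub>RR X\<^esub> of_q L X (1 / 2)"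
    using ring_hom_add[OF of_q_hom[of X], of "1 / 2" "1 / 2"] by (simp add: rat_ring_def)
  moreover have "of_q L X 1 = \<one>\<^bsub>RR X\<^esub>"
    using ring_hom_one[OF of_q_hom[of X]] by (simp add: rat_ring_def)
  ultimately have "of_q L X (1 / 2) \<oplus>\<^bsub>RR X\<^esub> of_q L X (1 / 2) = \<one>\<^bsub>RR X\<^esub>" by simp
  moreover have "of_q L X (1 / 2) \<otimes>\<^bsub>RR X\<^esub> (x \<oplus>\<^bsub>RR X\<^esub> x)
      = (of_q L X (1 / 2) \<oplus>\<^bsub>RR X\<^esub> of_q L X (1 / 2)) \<otimes>\<^bsub>RR X\<^esub> x"
    using x by (simp add: l_distr r_distr)
  ultimately show ?thesis using x by simp
qed

lemma infin_zero [simp]: "\<zero>\<^bsub>RR X\<^esub> \<in> El infin X"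
proof -
  interpret cring "RR X" by (rule line_cring)
  show ?thesis by (simp add: El_infin)
qed

lemma infin_uminus [simp]:
  assumes "d \<in> El infin X"
  shows "\<ominus>\<^bsub>RR X\<^esub> d \<in> El infin X"
proof -
  interpret cring "RR X" by (rule line_cring)
  show ?thesis using assms by (simp add: El_infin l_minus r_minus)
qed

lemma infin_\<rho> [simp]: "cod f = X \<Longrightarrow> d \<in> El infin X \<Longrightarrow> \<rho> f d \<in> El infin (dom f)"
  using \<rho>_ring(2)[of f X d d] by (simp add: El_infin \<rho>_ring(3))

lemma infin_closed [simp]: "d \<in> El infin X \<Longrightarrow> d \<in> carrier (RR X)"
  by (simp add: El_infin)

lemma infin_presheaf: "is_presheaf infin"
  unfolding is_presheaf_def by (auto simp: \<rho>_comp)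

lemma Comp_Ident' [simp]: "dom f = Y \<Longrightarrow> f \<odot> ide Y = f"
  using Comp_Ident[of f] by simp

lemma Ident_Comp' [simp]: "cod f = Y \<Longrightarrow> ide Y \<odot> f = f"
  using Ident_Comp[of f] by simp

declare Dom_Ident [simp] Cod_Ident [simp] Dom_Comp [simp] Cod_Comp [simp]

text \<open>
  Locality of equations whose two sides live at a stage \<open>h\<close> over \<open>X\<close>, for a cover of \<open>X\<close> itself.
\<close>

lemma line_local_eq:
  assumes "S \<in> Cov C X" "cod h = X" "a \<in> carrier (RR (dom h))" "b \<in> carrier (RR (dom h))"
    and "\<And>g. cod g = dom h \<Longrightarrow> h \<odot> g \<in> S \<Longrightarrow> \<rho> g a = \<rho> g b"
  shows "a = b"
proof (rule sheaf_separated[OF line_sheaf])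
  show "pull_sieve C h S \<in> Cov C (dom h)" using Cov_stable assms by blast
qed (use assms in \<open>auto simp: pull_sieve_def\<close>)

text \<open>
  The Kock--Lawvere axiom with the forcing removed: a function on the infinitesimals defined at stage
  \<open>X\<close> is affine, with unique coefficients that already exist at stage \<open>X\<close>.
\<close>

lemma Kock_Lawvere_global:
  assumes \<theta>: "\<theta> \<in> El (expo infin line) X"
  shows "\<exists>!p. p \<in> carrier (RR X) \<times> carrier (RR X) \<and>
    (\<forall>h. cod h = X \<longrightarrow> (\<forall>d\<in>El infin (dom h).
      \<theta> h d = \<rho> h (fst p) \<oplus>\<^bsub>RR (dom h)\<^esub> d \<otimes>\<^bsub>RR (dom h)\<^esub> \<rho> h (snd p)))"
proof -
  let ?\<phi> = "\<lambda>g (a, b). kj_all (dom g) infin (\<lambda>h d.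
    \<theta> (g \<odot> h) d = \<rho> h a \<oplus>\<^bsub>RR (dom h)\<^esub> d \<otimes>\<^bsub>RR (dom h)\<^esub> \<rho> h b)"
  have \<phi>: "?\<phi> g p \<longleftrightarrow> (\<forall>h. cod h = dom g \<longrightarrow> (\<forall>d\<in>El infin (dom h).
      \<theta> (g \<odot> h) d = \<rho> h (fst p) \<oplus>\<^bsub>RR (dom h)\<^esub> d \<otimes>\<^bsub>RR (dom h)\<^esub> \<rho> h (snd p)))" for g p
    by (simp add: split_beta kj_all_def)
  have El_prod: "El (prod_ob line line) Y = carrier (RR Y) \<times> carrier (RR Y)"
    and Res_prod: "Res (prod_ob line line) f p = (\<rho> f (fst p), \<rho> f (snd p))" for Y f p
    by (simp_all add: prod_ob_def map_prod_def split_beta)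
  have "kj_all X (expo infin line) (\<lambda>f \<theta>.
       kj_ex1 (dom f) (prod_ob line line) (\<lambda>g (a, b).
         kj_all (dom g) infin (\<lambda>h d.
           \<theta> (g \<odot> h) d = \<rho> h a \<oplus>\<^bsub>RR (dom h)\<^esub> d \<otimes>\<^bsub>RR (dom h)\<^esub> \<rho> h b)))"
    using Kock_Lawvere unfolding Kock_Lawvere_def by (rule spec)
  then have "kj_ex1 (dom (ide X)) (prod_ob line line) ?\<phi>"
    unfolding kj_all_def[of X] using \<theta> by (elim allE[of _ "ide X"]) simp
  then have ex1: "kj_ex1 X (prod_ob line line) ?\<phi>" by simp
  have "\<exists>!p. p \<in> El (prod_ob line line) X \<and> ?\<phi> (ide X) p"
  proof (rule kj_ex1_global[OF prod_sheaf[OF line_sheaf line_sheaf] ex1])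
    fix f p assume f: "cod f = X" and p: "p \<in> El (prod_ob line line) X" and "?\<phi> (ide X) p"
    then have "\<theta> h d = \<rho> h (fst p) \<oplus>\<^bsub>RR (dom h)\<^esub> d \<otimes>\<^bsub>RR (dom h)\<^esub> \<rho> h (snd p)"
      if "cod h = X" "d \<in> El infin (dom h)" for h d
      using that unfolding \<phi> by simp
    then show "?\<phi> f (Res (prod_ob line line) f p)"
      using f p unfolding \<phi> by (auto simp: El_prod Res_prod \<rho>_comp)
  next
    fix S p assume S: "S \<in> Cov C X" and p: "p \<in> El (prod_ob line line) X"
      and loc: "\<And>f. f \<in> S \<Longrightarrow> ?\<phi> f (Res (prod_ob line line) f p)"
    have p': "fst p \<in> carrier (RR X)" "snd p \<in> carrier (RR X)" using p by (auto simp: El_prod)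
    have "\<theta> h d = \<rho> h (fst p) \<oplus>\<^bsub>RR (dom h)\<^esub> d \<otimes>\<^bsub>RR (dom h)\<^esub> \<rho> h (snd p)"
      if h: "cod h = X" and d: "d \<in> El infin (dom h)" for h d
    proof (rule line_local_eq[OF S h])
      show "\<theta> h d \<in> carrier (RR (dom h))" using expo_closed[OF \<theta> h d] by simp
      show "\<rho> h (fst p) \<oplus>\<^bsub>RR (dom h)\<^esub> d \<otimes>\<^bsub>RR (dom h)\<^esub> \<rho> h (snd p) \<in> carrier (RR (dom h))"
        using p' h d by simp
      fix g assume g: "cod g = dom h" "h \<odot> g \<in> S"
      have "\<theta> (h \<odot> g \<odot> ide (dom g)) (\<rho> g d) =
          \<rho> (ide (dom g)) (\<rho> (h \<odot> g) (fst p)) \<oplus>\<^bsub>RR (dom g)\<^esub>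
          \<rho> g d \<otimes>\<^bsub>RR (dom g)\<^esub> \<rho> (ide (dom g)) (\<rho> (h \<odot> g) (snd p))"
        using loc[OF g(2)] g d unfolding \<phi>
        by (elim allE[of _ "ide (dom g)"]) (simp add: Res_prod)
      then have "\<theta> (h \<odot> g) (\<rho> g d) =
          \<rho> (h \<odot> g) (fst p) \<oplus>\<^bsub>RR (dom g)\<^esub> \<rho> g d \<otimes>\<^bsub>RR (dom g)\<^esub> \<rho> (h \<odot> g) (snd p)"
        using g h p' by (simp add: \<rho>_comp)
      moreover have "\<theta> (h \<odot> g) (\<rho> g d) = \<rho> g (\<theta> h d)"
        using expo_natural[OF \<theta> h g(1) d] by simp
      ultimately show "\<rho> g (\<theta> h d) =
          \<rho> g (\<rho> h (fst p) \<oplus>\<^bsub>RR (dom h)\<^esub> d \<otimes>\<^bsub>RR (dom h)\<^esub> \<rho> h (snd p))"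
        using g h d p' by (simp add: \<rho>_ring \<rho>_comp)
    qed
    then show "?\<phi> (ide X) p" unfolding \<phi> by simp
  qed
  moreover have "?\<phi> (ide X) p \<longleftrightarrow> (\<forall>h. cod h = X \<longrightarrow> (\<forall>d\<in>El infin (dom h).
      \<theta> h d = \<rho> h (fst p) \<oplus>\<^bsub>RR (dom h)\<^esub> d \<otimes>\<^bsub>RR (dom h)\<^esub> \<rho> h (snd p)))" for p
    unfolding \<phi> by (rule all_cong1) (auto simp: Dom_Ident)
  ultimately show ?thesis unfolding El_prod by (simp only:)
qed

text \<open>
  Both \<open>(0, b)\<close> and \<open>(0, c)\<close> are coefficients of the affine function \<open>d \<mapsto> d b\<close>. The infinitesimals
  have to range over all later stages, since a single stage may have none but \<open>0\<close>.
\<close>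

lemma microcancellation:
  assumes b: "b \<in> carrier (RR X)" and c: "c \<in> carrier (RR X)"
    and eq: "\<And>g d. cod g = X \<Longrightarrow> d \<in> El infin (dom g) \<Longrightarrow>
      d \<otimes>\<^bsub>RR (dom g)\<^esub> \<rho> g b = d \<otimes>\<^bsub>RR (dom g)\<^esub> \<rho> g c"
  shows "b = c"
proof -
  define \<theta> where "\<theta> = lam X infin (\<lambda>g d. d \<otimes>\<^bsub>RR (dom g)\<^esub> \<rho> g b)"
  have "\<theta> \<in> El (expo infin line) X"
    unfolding \<theta>_def using b by (intro lam_in_expo[OF infin_presheaf]) (simp_all add: \<rho>_ring \<rho>_comp)
  note ex1 = Kock_Lawvere_global[OF this]
  have \<theta>: "\<theta> h d = \<rho> h \<zero>\<^bsub>RR X\<^esub> \<oplus>\<^bsub>RR (dom h)\<^esub> d \<otimes>\<^bsub>RR (dom h)\<^esub> \<rho> h z"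
    if "z = b \<or> z = c" "cod h = X" "d \<in> El infin (dom h)" for h d z
  proof -
    interpret cring "RR (dom h)" by (rule line_cring)
    show ?thesis using that b c eq[OF that(2,3)] by (auto simp: \<theta>_def lam_apply \<rho>_ring)
  qed
  obtain p where p: "\<And>q. q \<in> carrier (RR X) \<times> carrier (RR X) \<and>
    (\<forall>h. cod h = X \<longrightarrow> (\<forall>d\<in>El infin (dom h).
      \<theta> h d = \<rho> h (fst q) \<oplus>\<^bsub>RR (dom h)\<^esub> d \<otimes>\<^bsub>RR (dom h)\<^esub> \<rho> h (snd q))) \<Longrightarrow> q = p"
    using ex1 by (rule ex1E) blast
  have "(\<zero>\<^bsub>RR X\<^esub>, b) = p" using b \<theta>[of b] by (intro p) simp
  also have "\<dots> = (\<zero>\<^bsub>RR X\<^esub>, c)" using c \<theta>[of c] by (intro p[symmetric]) simp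
  finally show ?thesis by simp
qed

section \<open>Derivatives\<close>

abbreviation funs where "funs X \<equiv> El fun_ob X"

lemma fun_closed [simp]: "\<psi> \<in> funs X \<Longrightarrow> cod f = X \<Longrightarrow> x \<in> carrier (RR (dom f)) \<Longrightarrow> \<psi> f x \<in> carrier (RR (dom f))"
  using expo_closed[of \<psi> line line X f x] by simp

lemma fun_ide_closed [simp]: "\<psi> \<in> funs X \<Longrightarrow> x \<in> carrier (RR X) \<Longrightarrow> \<psi> (ide X) x \<in> carrier (RR X)"
  using fun_closed[of \<psi> X "ide X" x] by simp

lemma fun_natural:
  "\<psi> \<in> funs X \<Longrightarrow> cod f = X \<Longrightarrow> cod g = dom f \<Longrightarrow> x \<in> carrier (RR (dom f)) \<Longrightarrow>
    \<psi> (f \<odot> g) (\<rho> g x) = \<rho> g (\<psi> f x)"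
  using expo_natural[of \<psi> line line X f g x] by simp

lemma fun_Res_closed [simp]: "cod f = X \<Longrightarrow> \<psi> \<in> funs X \<Longrightarrow> Res fun_ob f \<psi> \<in> funs (dom f)"
  using presheaf_closed[OF expo_presheaf[OF line_presheaf], of \<psi> line f] by simp

lemma fun_Res_ide:
  assumes "\<psi> \<in> funs X" "cod f = X" "x \<in> carrier (RR X)"
  shows "Res fun_ob f \<psi> (ide (dom f)) (\<rho> f x) = \<rho> f (\<psi> (ide X) x)"
  using fun_natural[of \<psi> X "ide X" f x] assms by (simp add: Res_expo_apply)

lemma fun_ext:
  assumes "\<psi> \<in> funs X" "\<chi> \<in> funs X"
    and "\<And>f x. cod f = X \<Longrightarrow> x \<in> carrier (RR (dom f)) \<Longrightarrow> \<psi> f x = \<chi> f x"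
  shows "\<psi> = \<chi>"
  using assms by (intro expo_ext[of \<psi> line line X \<chi>]) simp_all

lemma lam_in_funs:
  assumes "\<And>f x. cod f = X \<Longrightarrow> x \<in> carrier (RR (dom f)) \<Longrightarrow> F f x \<in> carrier (RR (dom f))"
    and "\<And>f g x. cod f = X \<Longrightarrow> cod g = dom f \<Longrightarrow> x \<in> carrier (RR (dom f)) \<Longrightarrow>
      F (f \<odot> g) (\<rho> g x) = \<rho> g (F f x)"
  shows "lam X line F \<in> funs X"
  using assms by (intro lam_in_expo[OF line_presheaf]) simp_all

text \<open>
  The nested quantifiers over \<open>x\<close> and then \<open>d\<close> can be merged: a restriction of \<open>x\<close> is again an
  element of the line at the stage of \<open>d\<close>.
\<close>

lemma is_deriv_pointwise:
  "is_deriv X \<psi> \<psi>' \<longleftrightarrow>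
    (\<forall>f x d. cod f = X \<longrightarrow> x \<in> carrier (RR (dom f)) \<longrightarrow> d \<in> El infin (dom f) \<longrightarrow>
      \<psi> f (x \<oplus>\<^bsub>RR (dom f)\<^esub> d) = \<psi> f x \<oplus>\<^bsub>RR (dom f)\<^esub> d \<otimes>\<^bsub>RR (dom f)\<^esub> \<psi>' f x)"
  (is "?L \<longleftrightarrow> ?R")
proof
  assume L: ?L
  show ?R
  proof (intro allI impI)
    fix f x d
    assume f: "cod f = X" and x: "x \<in> carrier (RR (dom f))" and d: "d \<in> El infin (dom f)"
    let ?i = "ide (dom f)"
    have "\<psi> (f \<odot> ?i) (\<rho> ?i x \<oplus>\<^bsub>RR (dom ?i)\<^esub> d) = \<psi> (f \<odot> ?i) (\<rho> ?i x)
        \<oplus>\<^bsub>RR (dom ?i)\<^esub> d \<otimes>\<^bsub>RR (dom ?i)\<^esub> \<psi>' (f \<odot> ?i) (\<rho> ?i x)"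
      using L f x d unfolding is_deriv_def kj_all_def El_line
      by (elim allE[of _ f] impE ballE[of _ _ x] allE[of _ ?i] ballE[of _ _ d]) simp_all
    then show "\<psi> f (x \<oplus>\<^bsub>RR (dom f)\<^esub> d) = \<psi> f x \<oplus>\<^bsub>RR (dom f)\<^esub> d \<otimes>\<^bsub>RR (dom f)\<^esub> \<psi>' f x"
      using x by simp
  qed
next
  assume R: ?R
  show ?L
    unfolding is_deriv_def kj_all_def El_line
  proof (intro allI impI ballI)
    fix f x g d
    assume "cod f = X" "x \<in> carrier (RR (dom f))" "cod g = dom f" "d \<in> El infin (dom g)"
    then show "\<psi> (f \<odot> g) (\<rho> g x \<oplus>\<^bsub>RR (dom g)\<^esub> d) = \<psi> (f \<odot> g) (\<rho> g x)
        \<oplus>\<^bsub>RR (dom g)\<^esub> d \<otimes>\<^bsub>RR (dom g)\<^esub> \<psi>' (f \<odot> g) (\<rho> g x)"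
      using R[rule_format, of "f \<odot> g" "\<rho> g x" d] by simp
  qed
qed

lemma is_derivD:
  "is_deriv X \<psi> \<psi>' \<Longrightarrow> cod f = X \<Longrightarrow> x \<in> carrier (RR (dom f)) \<Longrightarrow> d \<in> El infin (dom f) \<Longrightarrow>
    \<psi> f (x \<oplus>\<^bsub>RR (dom f)\<^esub> d) = \<psi> f x \<oplus>\<^bsub>RR (dom f)\<^esub> d \<otimes>\<^bsub>RR (dom f)\<^esub> \<psi>' f x"
  unfolding is_deriv_pointwise by blast

lemma is_derivI:
  "(\<And>f x d. cod f = X \<Longrightarrow> x \<in> carrier (RR (dom f)) \<Longrightarrow> d \<in> El infin (dom f) \<Longrightarrow>
    \<psi> f (x \<oplus>\<^bsub>RR (dom f)\<^esub> d) = \<psi> f x \<oplus>\<^bsub>RR (dom f)\<^esub> d \<otimes>\<^bsub>RR (dom f)\<^esub> \<psi>' f x) \<Longrightarrow>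
    is_deriv X \<psi> \<psi>'"
  unfolding is_deriv_pointwise by blast

text \<open>
  The slope of \<open>\<psi>\<close> at a point \<open>x\<close> of stage \<open>f\<close>, characterised by the increments of \<open>\<psi>\<close> at all stages
  over \<open>f\<close>. Increments at the stage of \<open>x\<close> alone need not determine it.
\<close>

lemma slope_unique:
  assumes \<psi>: "\<psi> \<in> funs X" and f: "cod f = X" and x: "x \<in> carrier (RR (dom f))"
    and b: "b \<in> carrier (RR (dom f))" and c: "c \<in> carrier (RR (dom f))"
    and eq: "\<And>z g d. z = b \<or> z = c \<Longrightarrow> cod g = dom f \<Longrightarrow> d \<in> El infin (dom g) \<Longrightarrow>
      \<psi> (f \<odot> g) (\<rho> g x \<oplus>\<^bsub>RR (dom g)\<^esub> d)
        = \<rho> g (\<psi> f x) \<oplus>\<^bsub>RR (dom g)\<^esub> d \<otimes>\<^bsub>RR (dom g)\<^esub> \<rho> g z"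
  shows "b = c"
proof (rule microcancellation[OF b c])
  fix g d assume g: "cod g = dom f" and d: "d \<in> El infin (dom g)"
  interpret cring "RR (dom g)" by (rule line_cring)
  have "\<rho> g (\<psi> f x) \<oplus>\<^bsub>RR (dom g)\<^esub> d \<otimes>\<^bsub>RR (dom g)\<^esub> \<rho> g b
      = \<rho> g (\<psi> f x) \<oplus>\<^bsub>RR (dom g)\<^esub> d \<otimes>\<^bsub>RR (dom g)\<^esub> \<rho> g c"
    using eq[OF _ g d, of b] eq[OF _ g d, of c] by simp
  from arg_cong[OF this, of "\<lambda>v. \<ominus>\<^bsub>RR (dom g)\<^esub> \<rho> g (\<psi> f x) \<oplus>\<^bsub>RR (dom g)\<^esub> v"]
  show "d \<otimes>\<^bsub>RR (dom g)\<^esub> \<rho> g b = d \<otimes>\<^bsub>RR (dom g)\<^esub> \<rho> g c"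
    using g d b c f x \<psi> by (simp add: r_neg1)
qed

lemma slope_exists:
  assumes \<psi>: "\<psi> \<in> funs X" and f: "cod f = X" and x: "x \<in> carrier (RR (dom f))"
  shows "\<exists>b\<in>carrier (RR (dom f)). \<forall>g d. cod g = dom f \<longrightarrow> d \<in> El infin (dom g) \<longrightarrow>
      \<psi> (f \<odot> g) (\<rho> g x \<oplus>\<^bsub>RR (dom g)\<^esub> d)
        = \<rho> g (\<psi> f x) \<oplus>\<^bsub>RR (dom g)\<^esub> d \<otimes>\<^bsub>RR (dom g)\<^esub> \<rho> g b"
proof -
  define \<theta> where "\<theta> = lam (dom f) infin (\<lambda>g d. \<psi> (f \<odot> g) (\<rho> g x \<oplus>\<^bsub>RR (dom g)\<^esub> d))"
  have "\<theta> \<in> El (expo infin line) (dom f)"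
    unfolding \<theta>_def
  proof (rule lam_in_expo[OF infin_presheaf])
    fix g d assume g: "cod g = dom f" and d: "d \<in> El infin (dom g)"
    show "\<psi> (f \<odot> g) (\<rho> g x \<oplus>\<^bsub>RR (dom g)\<^esub> d) \<in> El line (dom g)"
      using fun_closed[OF \<psi>, of "f \<odot> g"] f g x d by simp
    fix h assume h: "cod h = dom g"
    then show "\<psi> (f \<odot> (g \<odot> h)) (\<rho> (g \<odot> h) x \<oplus>\<^bsub>RR (dom (g \<odot> h))\<^esub> Res infin h d)
        = Res line h (\<psi> (f \<odot> g) (\<rho> g x \<oplus>\<^bsub>RR (dom g)\<^esub> d))"
      using fun_natural[OF \<psi>, of "f \<odot> g" h "\<rho> g x \<oplus>\<^bsub>RR (dom g)\<^esub> d"] f g x d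
      by (simp add: Comp_assoc \<rho>_ring \<rho>_comp)
  qed
  from ex1_implies_ex[OF Kock_Lawvere_global[OF this]]
  obtain a b where ab: "a \<in> carrier (RR (dom f))" "b \<in> carrier (RR (dom f))"
    and \<theta>: "\<And>g d. cod g = dom f \<Longrightarrow> d \<in> El infin (dom g) \<Longrightarrow>
      \<theta> g d = \<rho> g a \<oplus>\<^bsub>RR (dom g)\<^esub> d \<otimes>\<^bsub>RR (dom g)\<^esub> \<rho> g b"
    by (elim exE) auto
  have eq: "\<psi> (f \<odot> g) (\<rho> g x \<oplus>\<^bsub>RR (dom g)\<^esub> d)
      = \<rho> g a \<oplus>\<^bsub>RR (dom g)\<^esub> d \<otimes>\<^bsub>RR (dom g)\<^esub> \<rho> g b"
    if "cod g = dom f" "d \<in> El infin (dom g)" for g d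
    using \<theta>[OF that] that by (simp add: \<theta>_def lam_apply)
  \<comment> \<open>The affine map and the increment agree at \<open>d = 0\<close>, which identifies the constant term.\<close>
  have "a = \<psi> f x"
  proof -
    interpret cring "RR (dom f)" by (rule line_cring)
    show ?thesis using eq[of "ide (dom f)" "\<zero>\<^bsub>RR (dom f)\<^esub>"] ab f x by simp
  qed
  then show ?thesis using ab(2) eq by blast
qed

text \<open>
  Slopes exist and are unique at every point of every stage. Uniqueness makes the choice of slopes
  natural, hence an element of the function object at stage \<open>X\<close>.
\<close>

lemma deriv_exists:
  assumes \<psi>: "\<psi> \<in> funs X"
  shows "\<exists>\<psi>'\<in>funs X. is_deriv X \<psi> \<psi>'"
proof -
  let ?P = "\<lambda>f x b. b \<in> carrier (RR (dom f)) \<and>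
    (\<forall>g d. cod g = dom f \<longrightarrow> d \<in> El infin (dom g) \<longrightarrow>
      \<psi> (f \<odot> g) (\<rho> g x \<oplus>\<^bsub>RR (dom g)\<^esub> d)
        = \<rho> g (\<psi> f x) \<oplus>\<^bsub>RR (dom g)\<^esub> d \<otimes>\<^bsub>RR (dom g)\<^esub> \<rho> g b)"
  define s where "s f x = (SOME b. ?P f x b)" for f x
  have s: "?P f x (s f x)" if "cod f = X" "x \<in> carrier (RR (dom f))" for f x
    unfolding s_def using slope_exists[OF \<psi> that] unfolding Bex_def by (rule someI_ex)
  have s_closed: "s f x \<in> carrier (RR (dom f))" if "cod f = X" "x \<in> carrier (RR (dom f))" for f x
    using s[OF that] by (rule conjunct1)
  have s_eq: "\<psi> (f \<odot> g) (\<rho> g x \<oplus>\<^bsub>RR (dom g)\<^esub> d)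
        = \<rho> g (\<psi> f x) \<oplus>\<^bsub>RR (dom g)\<^esub> d \<otimes>\<^bsub>RR (dom g)\<^esub> \<rho> g (s f x)"
    if "cod f = X" "x \<in> carrier (RR (dom f))" "cod g = dom f" "d \<in> El infin (dom g)" for f x g d
    using conjunct2[OF s[OF that(1,2)]] that(3,4) by simp
  have s_natural: "s (f \<odot> k) (\<rho> k x) = \<rho> k (s f x)"
    if f: "cod f = X" and k: "cod k = dom f" and x: "x \<in> carrier (RR (dom f))" for f k x
  proof (rule slope_unique[OF \<psi>, of "f \<odot> k" "\<rho> k x"])
    have fk: "cod (f \<odot> k) = X" and kx: "\<rho> k x \<in> carrier (RR (dom (f \<odot> k)))" using f k x by simp_all
    then show "cod (f \<odot> k) = X" "\<rho> k x \<in> carrier (RR (dom (f \<odot> k)))"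
      "s (f \<odot> k) (\<rho> k x) \<in> carrier (RR (dom (f \<odot> k)))" by (simp_all only: s_closed)
    show "\<rho> k (s f x) \<in> carrier (RR (dom (f \<odot> k)))" using s_closed[OF f x] k f by simp
    fix z g d
    assume z: "z = s (f \<odot> k) (\<rho> k x) \<or> z = \<rho> k (s f x)"
      and g: "cod g = dom (f \<odot> k)" and d: "d \<in> El infin (dom g)"
    have "\<psi> (f \<odot> (k \<odot> g)) (\<rho> (k \<odot> g) x \<oplus>\<^bsub>RR (dom g)\<^esub> d)
        = \<rho> (k \<odot> g) (\<psi> f x) \<oplus>\<^bsub>RR (dom g)\<^esub> d \<otimes>\<^bsub>RR (dom g)\<^esub> \<rho> (k \<odot> g) (s f x)"
      using s_eq[OF f x, of "k \<odot> g" d] f k g d by simp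
    then have "\<psi> (f \<odot> k \<odot> g) (\<rho> g (\<rho> k x) \<oplus>\<^bsub>RR (dom g)\<^esub> d)
        = \<rho> g (\<psi> (f \<odot> k) (\<rho> k x)) \<oplus>\<^bsub>RR (dom g)\<^esub> d \<otimes>\<^bsub>RR (dom g)\<^esub> \<rho> g (\<rho> k (s f x))"
      using f k g x \<psi> s_closed[OF f x] by (simp add: Comp_assoc \<rho>_comp fun_natural)
    then show "\<psi> (f \<odot> k \<odot> g) (\<rho> g (\<rho> k x) \<oplus>\<^bsub>RR (dom g)\<^esub> d)
        = \<rho> g (\<psi> (f \<odot> k) (\<rho> k x)) \<oplus>\<^bsub>RR (dom g)\<^esub> d \<otimes>\<^bsub>RR (dom g)\<^esub> \<rho> g z"
      using z s_eq[OF fk kx g d] by (elim disjE) simp_all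
  qed
  have "lam X line s \<in> funs X" by (rule lam_in_funs[OF s_closed s_natural])
  moreover have "is_deriv X \<psi> (lam X line s)"
  proof (rule is_derivI)
    fix f x d assume fxd: "cod f = X" "x \<in> carrier (RR (dom f))" "d \<in> El infin (dom f)"
    show "\<psi> f (x \<oplus>\<^bsub>RR (dom f)\<^esub> d)
        = \<psi> f x \<oplus>\<^bsub>RR (dom f)\<^esub> d \<otimes>\<^bsub>RR (dom f)\<^esub> lam X line s f x"
      using s_eq[OF fxd(1,2), of "ide (dom f)" d] fxd \<psi> s_closed[OF fxd(1,2)]
      by (simp add: lam_apply)
  qed
  ultimately show ?thesis by (intro bexI[of _ "lam X line s"])
qed

lemma deriv_unique:
  assumes \<psi>: "\<psi> \<in> funs X" and \<chi>: "\<chi> \<in> funs X" "is_deriv X \<psi> \<chi>" and \<eta>: "\<eta> \<in> funs X" "is_deriv X \<psi> \<eta>"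
  shows "\<chi> = \<eta>"
proof (rule fun_ext[OF \<chi>(1) \<eta>(1)])
  fix f x assume f: "cod f = X" and x: "x \<in> carrier (RR (dom f))"
  show "\<chi> f x = \<eta> f x"
  proof (rule slope_unique[OF \<psi> f x])
    fix z g d assume z: "z = \<chi> f x \<or> z = \<eta> f x" and g: "cod g = dom f" and d: "d \<in> El infin (dom g)"
    have *: "\<psi> (f \<odot> g) (\<rho> g x \<oplus>\<^bsub>RR (dom g)\<^esub> d)
        = \<rho> g (\<psi> f x) \<oplus>\<^bsub>RR (dom g)\<^esub> d \<otimes>\<^bsub>RR (dom g)\<^esub> \<rho> g (\<psi>' f x)"
      if "\<psi>' \<in> funs X" "is_deriv X \<psi> \<psi>'" for \<psi>'
      using is_derivD[OF that(2), of "f \<odot> g" "\<rho> g x" d] that(1) \<psi> f g x d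
      by (simp add: fun_natural)
    show "\<psi> (f \<odot> g) (\<rho> g x \<oplus>\<^bsub>RR (dom g)\<^esub> d)
        = \<rho> g (\<psi> f x) \<oplus>\<^bsub>RR (dom g)\<^esub> d \<otimes>\<^bsub>RR (dom g)\<^esub> \<rho> g z"
      using z *[OF \<chi>] *[OF \<eta>] by (elim disjE) simp_all
  qed (use \<chi>(1) \<eta>(1) f x in simp_all)
qed

lemma the_el_eqI:
  assumes "a \<in> El A X" "P a" "\<And>b. b \<in> El A X \<Longrightarrow> P b \<Longrightarrow> b = a"
  shows "the_el X A P = a"
  unfolding the_el_def using assms by (intro the_equality) blast+

lemma deriv_eqI:
  assumes "\<psi> \<in> funs X" "\<psi>' \<in> funs X" "is_deriv X \<psi> \<psi>'"
  shows "deriv X \<psi> = \<psi>'"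
  unfolding deriv_def by (intro the_el_eqI assms deriv_unique[of \<psi> X])

lemma deriv_closed [simp]: "\<psi> \<in> funs X \<Longrightarrow> deriv X \<psi> \<in> funs X"
  and is_deriv_deriv: "\<psi> \<in> funs X \<Longrightarrow> is_deriv X \<psi> (deriv X \<psi>)"
  using deriv_exists deriv_eqI by blast+

section \<open>Integrals\<close>

lemma is_deriv_Res:
  assumes \<psi>: "is_deriv X \<psi> \<psi>'" and f: "cod f = X"
  shows "is_deriv (dom f) (Res fun_ob f \<psi>) (Res fun_ob f \<psi>')"
proof (rule is_derivI)
  fix g x d assume "cod g = dom f" "x \<in> carrier (RR (dom g))" "d \<in> El infin (dom g)"
  then show "Res fun_ob f \<psi> g (x \<oplus>\<^bsub>RR (dom g)\<^esub> d) =
      Res fun_ob f \<psi> g x \<oplus>\<^bsub>RR (dom g)\<^esub> d \<otimes>\<^bsub>RR (dom g)\<^esub> Res fun_ob f \<psi>' g x"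
    using is_derivD[OF \<psi>, of "f \<odot> g" x d] f by (simp add: Res_expo_apply)
qed

lemma is_deriv_local:
  assumes S: "S \<in> Cov C X" and \<psi>: "\<psi> \<in> funs X" "\<psi>' \<in> funs X"
    and loc: "\<And>f. f \<in> S \<Longrightarrow> is_deriv (dom f) (Res fun_ob f \<psi>) (Res fun_ob f \<psi>')"
  shows "is_deriv X \<psi> \<psi>'"
proof (rule is_derivI)
  fix h x d assume h: "cod h = X" and x: "x \<in> carrier (RR (dom h))" and d: "d \<in> El infin (dom h)"
  show "\<psi> h (x \<oplus>\<^bsub>RR (dom h)\<^esub> d) = \<psi> h x \<oplus>\<^bsub>RR (dom h)\<^esub> d \<otimes>\<^bsub>RR (dom h)\<^esub> \<psi>' h x"
  proof (rule line_local_eq[OF S h])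
    fix g assume g: "cod g = dom h" "h \<odot> g \<in> S"
    have "\<psi> (h \<odot> g) (\<rho> g x \<oplus>\<^bsub>RR (dom g)\<^esub> \<rho> g d)
        = \<psi> (h \<odot> g) (\<rho> g x) \<oplus>\<^bsub>RR (dom g)\<^esub> \<rho> g d \<otimes>\<^bsub>RR (dom g)\<^esub> \<psi>' (h \<odot> g) (\<rho> g x)"
      using is_derivD[OF loc[OF g(2)], of "ide (dom g)" "\<rho> g x" "\<rho> g d"] g h x d
      by (simp add: Res_expo_apply)
    moreover have "\<psi> (h \<odot> g) (\<rho> g x \<oplus>\<^bsub>RR (dom g)\<^esub> \<rho> g d) = \<rho> g (\<psi> h (x \<oplus>\<^bsub>RR (dom h)\<^esub> d))"
      using fun_natural[OF \<psi>(1) h g(1), of "x \<oplus>\<^bsub>RR (dom h)\<^esub> d"] g x d by (simp add: \<rho>_ring)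
    ultimately show "\<rho> g (\<psi> h (x \<oplus>\<^bsub>RR (dom h)\<^esub> d)) =
        \<rho> g (\<psi> h x \<oplus>\<^bsub>RR (dom h)\<^esub> d \<otimes>\<^bsub>RR (dom h)\<^esub> \<psi>' h x)"
      using g h x d \<psi> fun_natural[OF \<psi>(1) h g(1) x] fun_natural[OF \<psi>(2) h g(1) x]
      by (simp add: \<rho>_ring)
  qed (use \<psi> h x d in simp_all)
qed

lemma fun_Res_ide_arrow [simp]: "\<psi> \<in> funs X \<Longrightarrow> Res fun_ob (ide X) \<psi> = \<psi>"
  using presheaf_ide[OF expo_presheaf[OF line_presheaf], of \<psi> line X] by simp

text \<open>
  The integration axiom with the forcing removed. Being an antiderivative with a given value at a
  point is stable under restriction and local, so the local antiderivatives glue.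
\<close>

lemma antideriv_exists_unique:
  assumes \<psi>: "\<psi> \<in> funs X" and a: "a \<in> carrier (RR X)" and c: "c \<in> carrier (RR X)"
  shows "\<exists>!\<gamma>. \<gamma> \<in> funs X \<and> is_deriv X \<gamma> \<psi> \<and> \<gamma> (ide X) a = c"
proof -
  let ?i = "ide X"
  let ?\<phi> = "\<lambda>k \<gamma>. is_deriv (dom k) \<gamma> (Res fun_ob (?i \<odot> ?i \<odot> k) \<psi>) \<and>
    \<gamma> (ide (dom k)) (\<rho> (?i \<odot> k) a) = \<rho> k c"
  have \<phi>: "?\<phi> k \<gamma> \<longleftrightarrow> is_deriv (dom k) \<gamma> (Res fun_ob k \<psi>) \<and> \<gamma> (ide (dom k)) (\<rho> k a) = \<rho> k c"
    if "cod k = X" for k \<gamma>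
    using that by simp
  have \<phi>_ide: "?\<phi> ?i \<gamma> \<longleftrightarrow> is_deriv X \<gamma> \<psi> \<and> \<gamma> (ide X) a = c" for \<gamma>
    using \<psi> a c by simp
  have "kj_all X fun_ob (\<lambda>f \<psi>. kj_all (dom f) line (\<lambda>g a. kj_all (dom g) line (\<lambda>h c.
       kj_ex1 (dom h) fun_ob (\<lambda>k \<gamma>.
         is_deriv (dom k) \<gamma> (Res fun_ob (g \<odot> h \<odot> k) \<psi>) \<and>
         \<gamma> (ide (dom k)) (\<rho> (h \<odot> k) a) = \<rho> k c))))"
    using integration unfolding integration_axiom_def by (rule spec)
  \<comment> \<open>The function, the base point and the initial value are all taken at the stage \<open>X\<close> itself.\<close>
  from this[unfolded kj_all_def, THEN spec, of ?i, THEN mp, OF Cod_Ident, THEN bspec, of \<psi>,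
      THEN spec, of ?i, THEN mp, unfolded Dom_Ident, OF \<psi> Cod_Ident, THEN bspec, of a,
      THEN spec, of ?i, THEN mp, OF _ Cod_Ident, THEN bspec, of c]
  have ex1: "kj_ex1 X fun_ob ?\<phi>" using a c by (simp only: El_line Dom_Ident)
  have "\<exists>!\<gamma>. \<gamma> \<in> funs X \<and> ?\<phi> ?i \<gamma>"
  proof (rule kj_ex1_global[OF expo_sheaf[OF line_presheaf line_sheaf] ex1])
    fix f \<gamma> assume f: "cod f = X" and \<gamma>: "\<gamma> \<in> funs X" and "?\<phi> ?i \<gamma>"
    then have "is_deriv X \<gamma> \<psi>" "\<gamma> ?i a = c" by (simp_all only: \<phi>_ide)
    then show "?\<phi> f (Res fun_ob f \<gamma>)"
      unfolding \<phi>[OF f] using is_deriv_Res[OF _ f] fun_Res_ide[OF \<gamma> f a] by blast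
  next
    fix S \<gamma> assume S: "S \<in> Cov C X" and \<gamma>: "\<gamma> \<in> funs X"
      and forced: "\<And>f. f \<in> S \<Longrightarrow> ?\<phi> f (Res fun_ob f \<gamma>)"
    have loc: "is_deriv (dom f) (Res fun_ob f \<gamma>) (Res fun_ob f \<psi>)"
      "\<rho> f (\<gamma> ?i a) = \<rho> f c" if "f \<in> S" for f
      using forced[OF that] cover_cod[OF S that] fun_Res_ide[OF \<gamma> cover_cod[OF S that] a]
      by simp_all
    have "\<gamma> ?i a = c"
      by (rule line_local_eq[OF S, of ?i]) (use \<gamma> a c loc(2) in simp_all)
    then show "?\<phi> ?i \<gamma>" unfolding \<phi>_ide using is_deriv_local[OF S \<gamma> \<psi> loc(1)] by blast
  qed
  then show ?thesis unfolding \<phi>_ide .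
qed

lemma is_deriv_shift:
  assumes \<gamma>: "\<gamma> \<in> funs X" "is_deriv X \<gamma> \<psi>" and \<psi>: "\<psi> \<in> funs X" and c: "c \<in> carrier (RR X)"
  defines "\<eta> \<equiv> lam X line (\<lambda>f x. \<gamma> f x \<ominus>\<^bsub>RR (dom f)\<^esub> \<rho> f c)"
  shows "\<eta> \<in> funs X" "is_deriv X \<eta> \<psi>"
proof -
  show "\<eta> \<in> funs X"
    unfolding \<eta>_def using \<gamma>(1) c by (intro lam_in_funs) (simp_all add: \<rho>_ring \<rho>_comp fun_natural)
  show "is_deriv X \<eta> \<psi>"
  proof (rule is_derivI)
    fix f x d assume f: "cod f = X" and x: "x \<in> carrier (RR (dom f))" and d: "d \<in> El infin (dom f)"
    interpret cring "RR (dom f)" by (rule line_cring)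
    show "\<eta> f (x \<oplus>\<^bsub>RR (dom f)\<^esub> d) = \<eta> f x \<oplus>\<^bsub>RR (dom f)\<^esub> d \<otimes>\<^bsub>RR (dom f)\<^esub> \<psi> f x"
      using is_derivD[OF \<gamma>(2) f x d] f x d c \<gamma>(1) \<psi>
      by (simp add: \<eta>_def lam_apply a_minus_def a_ac)
  qed
qed

text \<open>
  The fundamental theorem: \<open>\<gamma> - \<gamma>(a)\<close> is the antiderivative vanishing at \<open>a\<close> that the integral
  refers to.
\<close>

lemma integral_eq:
  assumes \<gamma>: "\<gamma> \<in> funs X" "is_deriv X \<gamma> \<psi>" and \<psi>: "\<psi> \<in> funs X"
    and a: "a \<in> carrier (RR X)" and b: "b \<in> carrier (RR X)"
  shows "integral X a b \<psi> = \<gamma> (ide X) b \<ominus>\<^bsub>RR X\<^esub> \<gamma> (ide X) a"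
proof -
  interpret cring "RR X" by (rule line_cring)
  let ?\<eta> = "lam X line (\<lambda>f x. \<gamma> f x \<ominus>\<^bsub>RR (dom f)\<^esub> \<rho> f (\<gamma> (ide X) a))"
  have \<eta>: "?\<eta> (ide X) x = \<gamma> (ide X) x \<ominus>\<^bsub>RR X\<^esub> \<gamma> (ide X) a" if "x \<in> carrier (RR X)" for x
    using that \<gamma> a by (simp add: lam_apply)
  note shift = is_deriv_shift[OF \<gamma> \<psi> fun_ide_closed[OF \<gamma>(1) a]]
  have zero: "?\<eta> (ide X) a = \<zero>\<^bsub>RR X\<^esub>" using \<eta>[OF a] \<gamma> a by (simp add: r_neg a_minus_def)
  have "the_el X fun_ob (\<lambda>\<gamma>. is_deriv X \<gamma> \<psi> \<and> \<gamma> (ide X) a = \<zero>\<^bsub>RR X\<^esub>) = ?\<eta>"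
  proof (rule the_el_eqI)
    fix \<gamma>' assume "\<gamma>' \<in> funs X" "is_deriv X \<gamma>' \<psi> \<and> \<gamma>' (ide X) a = \<zero>\<^bsub>RR X\<^esub>"
    then show "\<gamma>' = ?\<eta>"
      using shift zero antideriv_exists_unique[OF \<psi> a ring_closed(1)] by (elim ex1E) (metis (no_types, lifting))
  qed (use shift zero in auto)
  then show ?thesis unfolding integral_def using \<eta>[OF b] by simp
qed

lemma antideriv_increment_unique:
  assumes \<gamma>: "\<gamma> \<in> funs X" "is_deriv X \<gamma> \<psi>" and \<eta>: "\<eta> \<in> funs X" "is_deriv X \<eta> \<psi>" and \<psi>: "\<psi> \<in> funs X"
    and a: "a \<in> carrier (RR X)" and b: "b \<in> carrier (RR X)"
  shows "\<gamma> (ide X) b \<ominus>\<^bsub>RR X\<^esub> \<gamma> (ide X) a = \<eta> (ide X) b \<ominus>\<^bsub>RR X\<^esub> \<eta> (ide X) a"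
  using integral_eq[OF \<gamma> \<psi> a b] integral_eq[OF \<eta> \<psi> a b] by simp

text \<open>
  The normalisation at \<open>0\<close> is a choice of base point that is preserved by restriction, sums and
  multiples, so that taking antiderivatives becomes a linear operator.
\<close>

definition antideriv where
  "antideriv X \<psi> =
    the_el X fun_ob (\<lambda>\<gamma>. is_deriv X \<gamma> \<psi> \<and> \<gamma> (ide X) \<zero>\<^bsub>RR X\<^esub> = \<zero>\<^bsub>RR X\<^esub>)"

lemma antideriv_spec:
  assumes "\<psi> \<in> funs X"
  shows "antideriv X \<psi> \<in> funs X" "is_deriv X (antideriv X \<psi>) \<psi>"
    "antideriv X \<psi> (ide X) \<zero>\<^bsub>RR X\<^esub> = \<zero>\<^bsub>RR X\<^esub>"
  using theI'[OF antideriv_exists_unique[OF assms ring_closed(1) ring_closed(1)]]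
  unfolding antideriv_def the_el_def by simp_all

lemma antideriv_eqI:
  assumes "\<psi> \<in> funs X" "\<gamma> \<in> funs X" "is_deriv X \<gamma> \<psi>" "\<gamma> (ide X) \<zero>\<^bsub>RR X\<^esub> = \<zero>\<^bsub>RR X\<^esub>"
  shows "antideriv X \<psi> = \<gamma>"
  unfolding antideriv_def the_el_def
  by (rule the1_equality[OF antideriv_exists_unique[OF assms(1) ring_closed(1) ring_closed(1)]])
    (simp add: assms)

lemma deriv_antideriv: "\<psi> \<in> funs X \<Longrightarrow> deriv X (antideriv X \<psi>) = \<psi>"
  by (rule deriv_eqI) (simp_all add: antideriv_spec)

section \<open>Linear operators and families of functionals\<close>

lemma padd_apply:
  "cod f = X \<Longrightarrow> x \<in> carrier (RR (dom f)) \<Longrightarrow>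
    padd X line \<psi> \<chi> f x = \<psi> f x \<oplus>\<^bsub>RR (dom f)\<^esub> \<chi> f x"
  by (simp add: padd_def lam_apply)

lemma pscale_apply:
  "cod f = X \<Longrightarrow> x \<in> carrier (RR (dom f)) \<Longrightarrow>
    pscale X line r \<psi> f x = \<rho> f r \<otimes>\<^bsub>RR (dom f)\<^esub> \<psi> f x"
  by (simp add: pscale_def lam_apply)

lemma padd_closed [simp]: "\<psi> \<in> funs X \<Longrightarrow> \<chi> \<in> funs X \<Longrightarrow> padd X line \<psi> \<chi> \<in> funs X"
  unfolding padd_def by (intro lam_in_funs) (simp_all add: \<rho>_ring fun_natural)

lemma pscale_closed [simp]: "r \<in> carrier (RR X) \<Longrightarrow> \<psi> \<in> funs X \<Longrightarrow> pscale X line r \<psi> \<in> funs X"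
  unfolding pscale_def by (intro lam_in_funs) (simp_all add: \<rho>_ring \<rho>_comp fun_natural)

lemma is_deriv_padd:
  assumes \<psi>: "\<psi> \<in> funs X" "\<psi>' \<in> funs X" "is_deriv X \<psi> \<psi>'"
    and \<chi>: "\<chi> \<in> funs X" "\<chi>' \<in> funs X" "is_deriv X \<chi> \<chi>'"
  shows "is_deriv X (padd X line \<psi> \<chi>) (padd X line \<psi>' \<chi>')"
proof (rule is_derivI)
  fix f x d assume fxd: "cod f = X" "x \<in> carrier (RR (dom f))" "d \<in> El infin (dom f)"
  interpret cring "RR (dom f)" by (rule line_cring)
  show "padd X line \<psi> \<chi> f (x \<oplus>\<^bsub>RR (dom f)\<^esub> d) =
      padd X line \<psi> \<chi> f x \<oplus>\<^bsub>RR (dom f)\<^esub> d \<otimes>\<^bsub>RR (dom f)\<^esub> padd X line \<psi>' \<chi>' f x"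
    using is_derivD[OF \<psi>(3) fxd] is_derivD[OF \<chi>(3) fxd] fxd \<psi>(1,2) \<chi>(1,2)
    by (simp add: padd_apply r_distr a_ac)
qed

lemma is_deriv_pscale:
  assumes r: "r \<in> carrier (RR X)" and \<psi>: "\<psi> \<in> funs X" "\<psi>' \<in> funs X" "is_deriv X \<psi> \<psi>'"
  shows "is_deriv X (pscale X line r \<psi>) (pscale X line r \<psi>')"
proof (rule is_derivI)
  fix f x d assume fxd: "cod f = X" "x \<in> carrier (RR (dom f))" "d \<in> El infin (dom f)"
  interpret cring "RR (dom f)" by (rule line_cring)
  show "pscale X line r \<psi> f (x \<oplus>\<^bsub>RR (dom f)\<^esub> d) =
      pscale X line r \<psi> f x \<oplus>\<^bsub>RR (dom f)\<^esub> d \<otimes>\<^bsub>RR (dom f)\<^esub> pscale X line r \<psi>' f x"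
    using is_derivD[OF \<psi>(3) fxd] fxd \<psi>(1,2) r
    by (simp add: pscale_apply r_distr m_ac)
qed

text \<open>
  A global element of the object of linear endomaps of the function object, given by its components.
\<close>

definition linear_operator where
  "linear_operator \<Phi> \<longleftrightarrow>
     (\<forall>X. \<forall>\<psi>\<in>funs X. \<Phi> X \<psi> \<in> funs X) \<and>
     (\<forall>f. \<forall>\<psi>\<in>funs (cod f). \<Phi> (dom f) (Res fun_ob f \<psi>) = Res fun_ob f (\<Phi> (cod f) \<psi>)) \<and>
     (\<forall>X. \<forall>\<psi>\<in>funs X. \<forall>\<chi>\<in>funs X.
        \<Phi> X (padd X line \<psi> \<chi>) = padd X line (\<Phi> X \<psi>) (\<Phi> X \<chi>)) \<and>
     (\<forall>X. \<forall>r\<in>carrier (RR X). \<forall>\<psi>\<in>funs X.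
        \<Phi> X (pscale X line r \<psi>) = pscale X line r (\<Phi> X \<psi>))"

lemma linear_operator_deriv: "linear_operator deriv"
  unfolding linear_operator_def
proof (intro conjI allI ballI)
  fix f \<psi> assume "\<psi> \<in> funs (cod f)"
  then show "deriv (dom f) (Res fun_ob f \<psi>) = Res fun_ob f (deriv (cod f) \<psi>)"
    by (intro deriv_eqI is_deriv_Res) (simp_all add: is_deriv_deriv)
qed (simp_all add: deriv_eqI is_deriv_padd is_deriv_pscale is_deriv_deriv)

text \<open>
  By uniqueness it suffices that restrictions, sums and multiples of normalised antiderivatives are
  again normalised antiderivatives.
\<close>

lemma linear_operator_antideriv: "linear_operator antideriv"
  unfolding linear_operator_def
proof (intro conjI allI ballI)
  fix f \<psi> assume \<psi>: "\<psi> \<in> funs (cod f)"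
  show "antideriv (dom f) (Res fun_ob f \<psi>) = Res fun_ob f (antideriv (cod f) \<psi>)"
    using \<psi> antideriv_spec[OF \<psi>] fun_Res_ide[of "antideriv (cod f) \<psi>" "cod f" f "\<zero>\<^bsub>RR (cod f)\<^esub>"]
    by (intro antideriv_eqI is_deriv_Res) (simp_all add: \<rho>_ring)
next
  fix X \<psi> \<chi> assume \<psi>: "\<psi> \<in> funs X" and \<chi>: "\<chi> \<in> funs X"
  interpret cring "RR X" by (rule line_cring)
  show "antideriv X (padd X line \<psi> \<chi>) = padd X line (antideriv X \<psi>) (antideriv X \<chi>)"
    using \<psi> \<chi> antideriv_spec[OF \<psi>] antideriv_spec[OF \<chi>]
    by (intro antideriv_eqI is_deriv_padd) (simp_all add: padd_apply)
next
  fix X r \<psi> assume r: "r \<in> carrier (RR X)" and \<psi>: "\<psi> \<in> funs X"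
  interpret cring "RR X" by (rule line_cring)
  show "antideriv X (pscale X line r \<psi>) = pscale X line r (antideriv X \<psi>)"
    using r \<psi> antideriv_spec[OF \<psi>]
    by (intro antideriv_eqI is_deriv_pscale) (simp_all add: pscale_apply)
qed (simp add: antideriv_spec)

text \<open>
  A global element of the object of maps from the line to distributions, in uncurried form:
  \<open>F X t \<psi>\<close> is the value of the distribution \<open>F(t)\<close> at \<open>\<psi>\<close>, where \<open>t\<close> and \<open>\<psi>\<close> live at the same stage
  \<open>X\<close>. Calculations with such families involve no restriction maps.
\<close>

definition linear_family where
  "linear_family F \<longleftrightarrow>
     (\<forall>X. \<forall>t\<in>carrier (RR X). \<forall>\<psi>\<in>funs X. F X t \<psi> \<in> carrier (RR X)) \<and>
     (\<forall>f. \<forall>t\<in>carrier (RR (cod f)). \<forall>\<psi>\<in>funs (cod f).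
        F (dom f) (\<rho> f t) (Res fun_ob f \<psi>) = \<rho> f (F (cod f) t \<psi>)) \<and>
     (\<forall>X. \<forall>t\<in>carrier (RR X). \<forall>\<psi>\<in>funs X. \<forall>\<chi>\<in>funs X.
        F X t (padd X line \<psi> \<chi>) = F X t \<psi> \<oplus>\<^bsub>RR X\<^esub> F X t \<chi>) \<and>
     (\<forall>X. \<forall>t\<in>carrier (RR X). \<forall>r\<in>carrier (RR X). \<forall>\<psi>\<in>funs X.
        F X t (pscale X line r \<psi>) = r \<otimes>\<^bsub>RR X\<^esub> F X t \<psi>)"

lemma linear_family_closed:
  "linear_family F \<Longrightarrow> t \<in> carrier (RR X) \<Longrightarrow> \<psi> \<in> funs X \<Longrightarrow> F X t \<psi> \<in> carrier (RR X)"
  by (simp add: linear_family_def)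

lemma linear_family_natural:
  "linear_family F \<Longrightarrow> cod f = X \<Longrightarrow> t \<in> carrier (RR X) \<Longrightarrow> \<psi> \<in> funs X \<Longrightarrow>
    F (dom f) (\<rho> f t) (Res fun_ob f \<psi>) = \<rho> f (F X t \<psi>)"
  by (auto simp: linear_family_def)

lemma linear_family_linear:
  assumes "linear_family F" "t \<in> carrier (RR X)" "\<psi> \<in> funs X"
  shows "\<chi> \<in> funs X \<Longrightarrow> F X t (padd X line \<psi> \<chi>) = F X t \<psi> \<oplus>\<^bsub>RR X\<^esub> F X t \<chi>"
    and "r \<in> carrier (RR X) \<Longrightarrow> F X t (pscale X line r \<psi>) = r \<otimes>\<^bsub>RR X\<^esub> F X t \<psi>"
  using assms by (simp_all add: linear_family_def)

lemma linear_family_operator: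
  assumes "linear_family F" "linear_operator \<Phi>"
  shows "linear_family (\<lambda>X t \<psi>. F X t (\<Phi> X \<psi>))"
  using assms unfolding linear_family_def linear_operator_def by simp

section \<open>Even and odd parts\<close>

definition even_part where
  "even_part X t \<psi> = of_q L X (1 / 2) \<otimes>\<^bsub>RR X\<^esub>
     (\<psi> (ide X) (\<ominus>\<^bsub>RR X\<^esub> t) \<oplus>\<^bsub>RR X\<^esub> \<psi> (ide X) t)"

definition odd_part where
  "odd_part X t \<psi> = of_q L X (1 / 2) \<otimes>\<^bsub>RR X\<^esub>
     (\<psi> (ide X) t \<ominus>\<^bsub>RR X\<^esub> \<psi> (ide X) (\<ominus>\<^bsub>RR X\<^esub> t))"

lemma linear_family_even_part: "linear_family even_part"
  unfolding linear_family_def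
proof (intro conjI allI ballI)
  fix f t \<psi> assume t: "t \<in> carrier (RR (cod f))" and \<psi>: "\<psi> \<in> funs (cod f)"
  show "even_part (dom f) (\<rho> f t) (Res fun_ob f \<psi>) = \<rho> f (even_part (cod f) t \<psi>)"
    using t \<psi> fun_Res_ide[OF \<psi> refl t] fun_Res_ide[OF \<psi> refl, of "\<ominus>\<^bsub>RR (cod f)\<^esub> t"]
    by (simp add: even_part_def \<rho>_ring \<rho>_of_q)
next
  fix X t \<psi> \<chi> assume *: "t \<in> carrier (RR X)" "\<psi> \<in> funs X" "\<chi> \<in> funs X"
  interpret cring "RR X" by (rule line_cring)
  show "even_part X t (padd X line \<psi> \<chi>) = even_part X t \<psi> \<oplus>\<^bsub>RR X\<^esub> even_part X t \<chi>"
    using * by (simp add: even_part_def padd_apply r_distr a_ac)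
next
  fix X t r \<psi> assume *: "t \<in> carrier (RR X)" "r \<in> carrier (RR X)" "\<psi> \<in> funs X"
  interpret cring "RR X" by (rule line_cring)
  show "even_part X t (pscale X line r \<psi>) = r \<otimes>\<^bsub>RR X\<^esub> even_part X t \<psi>"
    using * by (simp add: even_part_def pscale_apply r_distr m_ac)
qed (simp add: even_part_def)

lemma linear_family_odd_part: "linear_family odd_part"
  unfolding linear_family_def
proof (intro conjI allI ballI)
  fix f t \<psi> assume t: "t \<in> carrier (RR (cod f))" and \<psi>: "\<psi> \<in> funs (cod f)"
  show "odd_part (dom f) (\<rho> f t) (Res fun_ob f \<psi>) = \<rho> f (odd_part (cod f) t \<psi>)"
    using t \<psi> fun_Res_ide[OF \<psi> refl t] fun_Res_ide[OF \<psi> refl, of "\<ominus>\<^bsub>RR (cod f)\<^esub> t"]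
    by (simp add: odd_part_def \<rho>_ring \<rho>_of_q)
next
  fix X t \<psi> \<chi> assume *: "t \<in> carrier (RR X)" "\<psi> \<in> funs X" "\<chi> \<in> funs X"
  interpret cring "RR X" by (rule line_cring)
  show "odd_part X t (padd X line \<psi> \<chi>) = odd_part X t \<psi> \<oplus>\<^bsub>RR X\<^esub> odd_part X t \<chi>"
    using * by (simp add: odd_part_def padd_apply r_distr a_ac a_minus_def minus_add)
next
  fix X t r \<psi> assume *: "t \<in> carrier (RR X)" "r \<in> carrier (RR X)" "\<psi> \<in> funs X"
  interpret cring "RR X" by (rule line_cring)
  show "odd_part X t (pscale X line r \<psi>) = r \<otimes>\<^bsub>RR X\<^esub> odd_part X t \<psi>"
    using * by (simp add: odd_part_def pscale_apply r_distr m_ac a_minus_def r_minus)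
qed (simp add: odd_part_def)

text \<open>
  At \<open>-t\<close> the argument moves by \<open>-d\<close>, so the two first-order terms enter with opposite signs and the
  derivative exchanges even and odd parts.
\<close>

lemma even_odd_increment:
  assumes t: "t \<in> carrier (RR X)" and d: "d \<in> El infin X" and \<psi>: "\<psi> \<in> funs X"
  shows "even_part X (t \<oplus>\<^bsub>RR X\<^esub> d) \<psi>
      = even_part X t \<psi> \<oplus>\<^bsub>RR X\<^esub> d \<otimes>\<^bsub>RR X\<^esub> odd_part X t (deriv X \<psi>)" (is ?even)
    and "odd_part X (t \<oplus>\<^bsub>RR X\<^esub> d) \<psi>
      = odd_part X t \<psi> \<oplus>\<^bsub>RR X\<^esub> d \<otimes>\<^bsub>RR X\<^esub> even_part X t (deriv X \<psi>)" (is ?odd)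
proof -
  interpret cring "RR X" by (rule line_cring)
  let ?e = "\<lambda>\<psi> s. \<psi> (ide X) s"
  have right: "?e \<psi> (t \<oplus>\<^bsub>RR X\<^esub> d) = ?e \<psi> t \<oplus>\<^bsub>RR X\<^esub> d \<otimes>\<^bsub>RR X\<^esub> ?e (deriv X \<psi>) t"
    using is_derivD[OF is_deriv_deriv[OF \<psi>], of "ide X" t d] t d by simp
  have left: "?e \<psi> (\<ominus>\<^bsub>RR X\<^esub> (t \<oplus>\<^bsub>RR X\<^esub> d)) = ?e \<psi> (\<ominus>\<^bsub>RR X\<^esub> t)
      \<oplus>\<^bsub>RR X\<^esub> (\<ominus>\<^bsub>RR X\<^esub> d) \<otimes>\<^bsub>RR X\<^esub> ?e (deriv X \<psi>) (\<ominus>\<^bsub>RR X\<^esub> t)"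
    using is_derivD[OF is_deriv_deriv[OF \<psi>], of "ide X" "\<ominus>\<^bsub>RR X\<^esub> t" "\<ominus>\<^bsub>RR X\<^esub> d"] t d
    by (simp add: minus_add)
  note closed = t d \<psi> fun_ide_closed[OF \<psi>] fun_ide_closed[OF deriv_closed[OF \<psi>]]
  show ?even
    unfolding even_part_def odd_part_def left right
    using closed by (simp add: r_distr l_distr a_ac m_ac a_minus_def l_minus r_minus)
  show ?odd
    unfolding even_part_def odd_part_def left right
    using closed by (simp add: r_distr l_distr a_ac m_ac a_minus_def l_minus r_minus minus_add)
qed

section \<open>Evolving distributions\<close>

lemma El_distr: "El distr X = {\<mu> \<in> El (expo fun_ob line) X. is_linear X \<mu>}"
  and Res_distr: "Res distr = Res (expo fun_ob line)"
  by (simp_all add: distr_def subob_def)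

text \<open>
  Currying a linear family: \<open>functional F X t\<close> is the distribution at time \<open>t\<close>, and \<open>evolution F X\<close>
  the evolving distribution, both as elements at stage \<open>X\<close>.
\<close>

definition functional where
  "functional F X t = lam X fun_ob (\<lambda>f \<psi>. F (dom f) (\<rho> f t) \<psi>)"

definition evolution where
  "evolution F X = lam X line (\<lambda>f t. functional F (dom f) t)"

lemma functional_apply:
  "cod f = X \<Longrightarrow> \<psi> \<in> funs (dom f) \<Longrightarrow> functional F X t f \<psi> = F (dom f) (\<rho> f t) \<psi>"
  by (simp add: functional_def lam_apply)

lemma evolution_apply:
  "cod f = X \<Longrightarrow> t \<in> carrier (RR (dom f)) \<Longrightarrow> evolution F X f t = functional F (dom f) t"
  by (simp add: evolution_def lam_apply)

lemma functional_in_distr: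
  assumes F: "linear_family F" and t: "t \<in> carrier (RR X)"
  shows "functional F X t \<in> El distr X"
proof -
  have "functional F X t \<in> El (expo fun_ob line) X"
    unfolding functional_def
  proof (rule lam_in_expo[OF expo_presheaf[OF line_presheaf]])
    fix f \<psi> assume f: "cod f = X" and \<psi>: "\<psi> \<in> funs (dom f)"
    show "F (dom f) (\<rho> f t) \<psi> \<in> El line (dom f)"
      using linear_family_closed[OF F _ \<psi>] f t by simp
    fix g assume g: "cod g = dom f"
    show "F (dom (f \<odot> g)) (\<rho> (f \<odot> g) t) (Res fun_ob g \<psi>) = Res line g (F (dom f) (\<rho> f t) \<psi>)"
      using linear_family_natural[OF F g _ \<psi>] f t g by (simp add: \<rho>_comp)
  qed
  moreover have "is_linear X (functional F X t)"
    unfolding is_linear_def kj_all_def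
  proof (intro conjI allI impI ballI)
    fix f \<psi> g \<chi> assume f: "cod f = X" and \<psi>: "\<psi> \<in> funs (dom f)"
      and g: "cod g = dom f" and \<chi>: "\<chi> \<in> funs (dom g)"
    show "functional F X t (f \<odot> g) (padd (dom g) line (Res fun_ob g \<psi>) \<chi>) =
        functional F X t (f \<odot> g) (Res fun_ob g \<psi>) \<oplus>\<^bsub>RR (dom g)\<^esub> functional F X t (f \<odot> g) \<chi>"
      using linear_family_linear(1)[OF F _ _ \<chi>, of "\<rho> (f \<odot> g) t" "Res fun_ob g \<psi>"]
        fun_Res_closed[OF g \<psi>] f g \<chi> t by (simp add: functional_apply \<rho>_comp)
  next
    fix f r g \<psi> assume f: "cod f = X" and r: "r \<in> El line (dom f)"
      and g: "cod g = dom f" and \<psi>: "\<psi> \<in> funs (dom g)"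
    show "functional F X t (f \<odot> g) (pscale (dom g) line (\<rho> g r) \<psi>) =
        \<rho> g r \<otimes>\<^bsub>RR (dom g)\<^esub> functional F X t (f \<odot> g) \<psi>"
      using linear_family_linear(2)[OF F _ \<psi>, of "\<rho> (f \<odot> g) t" "\<rho> g r"] f g \<psi> t r
      by (simp add: functional_apply \<rho>_comp)
  qed
  ultimately show ?thesis by (simp add: El_distr)
qed

lemma functional_Res:
  assumes "cod g = X" "t \<in> carrier (RR X)"
  shows "functional F (dom g) (\<rho> g t) = Res distr g (functional F X t)"
  unfolding Res_distr Res_expo functional_def[of F "dom g"]
  using assms by (intro lam_cong) (simp add: functional_apply \<rho>_comp)

lemma evolution_in_evol:
  assumes "linear_family F"
  shows "evolution F X \<in> El evol_ob X"
  unfolding evolution_def using assms functional_Res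
  by (intro lam_in_expo[OF line_presheaf]) (simp_all add: functional_in_distr)

text \<open>
  Naturality of \<open>Q\<close> in time combined with naturality of the distribution \<open>Q(t)\<close> in the test function.
  The distribution on the left is evaluated at the identity, that is, at its own stage.
\<close>

lemma evol_natural:
  assumes Q: "Q \<in> El evol_ob X" and f: "cod f = X" and t: "t \<in> carrier (RR (dom f))"
    and g: "cod g = dom f" and h: "cod h = dom g" and \<psi>: "\<psi> \<in> funs (dom g)"
  shows "Q (f \<odot> (g \<odot> h)) (\<rho> (g \<odot> h) t) (ide (dom h)) (Res fun_ob h \<psi>) = \<rho> h (Q f t g \<psi>)"
proof -
  have gh: "cod (g \<odot> h) = dom f" using g h by simp
  have \<mu>: "Q f t \<in> El (expo fun_ob line) (dom f)"
    using expo_closed[OF Q f, of t] t by (simp add: El_distr)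
  have "Q (f \<odot> (g \<odot> h)) (\<rho> (g \<odot> h) t) = Res (expo fun_ob line) (g \<odot> h) (Q f t)"
    using expo_natural[OF Q f gh, of t] t by (simp add: Res_distr)
  then have "Q (f \<odot> (g \<odot> h)) (\<rho> (g \<odot> h) t) (ide (dom h)) (Res fun_ob h \<psi>)
      = Q f t (g \<odot> h) (Res fun_ob h \<psi>)"
    using g h \<psi> by (simp add: Res_expo_apply)
  also have "\<dots> = \<rho> h (Q f t g \<psi>)"
    using expo_natural[OF \<mu> g h \<psi>] by simp
  finally show ?thesis .
qed

text \<open>
  At a fixed time and test function this is microcancellation. The infinitesimal \<open>d\<close> must live at a
  stage \<open>h\<close> over the stage \<open>g\<close> of the test function, whereas in \<open>is_dot\<close> it lives at the stage of the
  time variable; so time is first restricted to \<open>g \<odot> h\<close>, and naturality translates back.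
\<close>

lemma is_dot_unique:
  assumes Q: "Q \<in> El evol_ob X"
    and A: "A \<in> El evol_ob X" "is_dot X Q A" and B: "B \<in> El evol_ob X" "is_dot X Q B"
  shows "A = B"
proof (rule expo_ext[OF A(1) B(1)])
  fix f t assume f: "cod f = X" and "t \<in> El line (dom f)"
  then have t: "t \<in> carrier (RR (dom f))" by simp
  have distr: "P f t \<in> El (expo fun_ob line) (dom f)" if "P \<in> El evol_ob X" for P
    using expo_closed[OF that f, of t] t by (simp add: El_distr)
  show "A f t = B f t"
  proof (rule expo_ext[OF distr[OF A(1)] distr[OF B(1)]])
    fix g \<psi> assume g: "cod g = dom f" and \<psi>: "\<psi> \<in> funs (dom g)"
    have closed: "P f t g \<psi> \<in> carrier (RR (dom g))" if "P \<in> El evol_ob X" for P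
      using expo_closed[OF distr[OF that] g \<psi>] by simp
    show "A f t g \<psi> = B f t g \<psi>"
    proof (rule microcancellation[OF closed[OF A(1)] closed[OF B(1)]])
      fix h d assume h: "cod h = dom g" and d: "d \<in> El infin (dom h)"
      interpret cring "RR (dom h)" by (rule line_cring)
      have gh: "cod (g \<odot> h) = dom f" using g h by simp
      let ?q = "\<rho> h (Q f t g \<psi>)"
      let ?v = "Q (f \<odot> (g \<odot> h)) (\<rho> (g \<odot> h) t \<oplus>\<^bsub>RR (dom h)\<^esub> d) (ide (dom h)) (Res fun_ob h \<psi>)"
      have incr: "?v = ?q \<oplus>\<^bsub>RR (dom h)\<^esub> d \<otimes>\<^bsub>RR (dom h)\<^esub> \<rho> h (P f t g \<psi>)"
        if P: "P \<in> El evol_ob X" "is_dot X Q P" for P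
      proof -
        have "Q (f \<odot> (g \<odot> h)) (\<rho> (g \<odot> h) t \<oplus>\<^bsub>RR (dom (g \<odot> h))\<^esub> d) =
            padd (dom (g \<odot> h)) fun_ob (Q (f \<odot> (g \<odot> h)) (\<rho> (g \<odot> h) t))
              (pscale (dom (g \<odot> h)) fun_ob d (P (f \<odot> (g \<odot> h)) (\<rho> (g \<odot> h) t)))"
          using P(2)[unfolded is_dot_def kj_all_def, THEN spec, THEN mp, OF f, THEN bspec, of t,
              THEN spec, THEN mp, OF _ gh, THEN bspec, of d] t d g h by simp
        then show ?thesis
          using evol_natural[OF Q f t g h \<psi>] evol_natural[OF P(1) f t g h \<psi>] g h d \<psi>
          by (simp add: padd_def pscale_def lam_apply)
      qed
      have "?q \<oplus>\<^bsub>RR (dom h)\<^esub> d \<otimes>\<^bsub>RR (dom h)\<^esub> \<rho> h (A f t g \<psi>)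
          = ?q \<oplus>\<^bsub>RR (dom h)\<^esub> d \<otimes>\<^bsub>RR (dom h)\<^esub> \<rho> h (B f t g \<psi>)"
        using incr[OF A] incr[OF B] by simp
      from arg_cong[OF this, of "\<lambda>v. \<ominus>\<^bsub>RR (dom h)\<^esub> ?q \<oplus>\<^bsub>RR (dom h)\<^esub> v"]
      show "d \<otimes>\<^bsub>RR (dom h)\<^esub> \<rho> h (A f t g \<psi>) = d \<otimes>\<^bsub>RR (dom h)\<^esub> \<rho> h (B f t g \<psi>)"
        using h d closed[OF A(1)] closed[OF B(1)] closed[OF Q] by (simp add: r_neg1)
    qed
  qed
qed

text \<open>
  Increments of \<open>F\<close> compared stage by stage say that \<open>G\<close> is a time derivative of \<open>F\<close>; uniqueness
  identifies it with the described one.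
\<close>

lemma dot_evolution:
  assumes F: "linear_family F" and G: "linear_family G"
    and incr: "\<And>Y t d \<psi>. t \<in> carrier (RR Y) \<Longrightarrow> d \<in> El infin Y \<Longrightarrow> \<psi> \<in> funs Y \<Longrightarrow>
      F Y (t \<oplus>\<^bsub>RR Y\<^esub> d) \<psi> = F Y t \<psi> \<oplus>\<^bsub>RR Y\<^esub> d \<otimes>\<^bsub>RR Y\<^esub> G Y t \<psi>"
  shows "dot X (evolution F X) = evolution G X"
proof -
  note in_evol = evolution_in_evol[OF F] evolution_in_evol[OF G]
  have is_dot: "is_dot X (evolution F X) (evolution G X)"
    unfolding is_dot_def kj_all_def
  proof (intro allI impI ballI)
    fix f t g d assume f: "cod f = X" and "t \<in> El line (dom f)"
      and g: "cod g = dom f" and d: "d \<in> El infin (dom g)"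
    then have t: "\<rho> g t \<in> carrier (RR (dom g))" by simp
    have "functional F (dom g) (\<rho> g t \<oplus>\<^bsub>RR (dom g)\<^esub> d) =
        padd (dom g) fun_ob (functional F (dom g) (\<rho> g t))
          (pscale (dom g) fun_ob d (functional G (dom g) (\<rho> g t)))"
      unfolding functional_def[of F "dom g" "_ \<oplus>\<^bsub>RR (dom g)\<^esub> _"] padd_def
      using t d incr
      by (intro lam_cong) (simp add: functional_apply pscale_def lam_apply \<rho>_ring)
    then show "evolution F X (f \<odot> g) (\<rho> g t \<oplus>\<^bsub>RR (dom g)\<^esub> d) =
        padd (dom g) fun_ob (evolution F X (f \<odot> g) (\<rho> g t))
          (pscale (dom g) fun_ob d (evolution G X (f \<odot> g) (\<rho> g t)))"
      using f g t d by (simp add: evolution_apply)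
  qed
  show ?thesis
    unfolding dot_def
    by (intro the_el_eqI in_evol is_dot is_dot_unique[OF in_evol(1) _ _ in_evol(2) is_dot])
qed

text \<open>
  The second hypothesis on increments says that \<open>G\<close> has time derivative \<open>\<psi> \<mapsto> F(t)(\<psi>'')\<close>, which is the
  Laplace operator applied to \<open>F(t)\<close>.
\<close>

lemma wave_solution_evolution:
  assumes F: "linear_family F" and G: "linear_family G"
    and F_incr: "\<And>Y t d \<psi>. t \<in> carrier (RR Y) \<Longrightarrow> d \<in> El infin Y \<Longrightarrow> \<psi> \<in> funs Y \<Longrightarrow>
      F Y (t \<oplus>\<^bsub>RR Y\<^esub> d) \<psi> = F Y t \<psi> \<oplus>\<^bsub>RR Y\<^esub> d \<otimes>\<^bsub>RR Y\<^esub> G Y t \<psi>"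
    and G_incr: "\<And>Y t d \<psi>. t \<in> carrier (RR Y) \<Longrightarrow> d \<in> El infin Y \<Longrightarrow> \<psi> \<in> funs Y \<Longrightarrow>
      G Y (t \<oplus>\<^bsub>RR Y\<^esub> d) \<psi>
        = G Y t \<psi> \<oplus>\<^bsub>RR Y\<^esub> d \<otimes>\<^bsub>RR Y\<^esub> F Y t (deriv Y (deriv Y \<psi>))"
  shows "wave_solution X (evolution F X)"
    and "initial_value X (evolution F X) = functional F X \<zero>\<^bsub>RR X\<^esub>"
    and "initial_speed X (evolution F X) = functional G X \<zero>\<^bsub>RR X\<^esub>"
proof -
  let ?H = "\<lambda>Y t \<psi>. F Y t (deriv Y (deriv Y \<psi>))"
  have H: "linear_family ?H"
    by (rule linear_family_operator[OF linear_family_operator[OF F linear_operator_deriv]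
          linear_operator_deriv])
  have dot1: "dot X (evolution F X) = evolution G X" by (rule dot_evolution[OF F G F_incr])
  have dot2: "dot X (evolution G X) = evolution ?H X" by (rule dot_evolution[OF G H G_incr])
  have "evolution ?H X f t = Laplace (dom f) (evolution F X f t)"
    if "cod f = X" "t \<in> carrier (RR (dom f))" for f t
    using that unfolding Laplace_def
    by (simp add: evolution_apply) (auto simp: functional_def[of ?H] functional_apply intro!: lam_cong)
  then show "wave_solution X (evolution F X)"
    using evolution_in_evol[OF F] by (simp add: wave_solution_def kj_all_def dot1 dot2)
  show "initial_value X (evolution F X) = functional F X \<zero>\<^bsub>RR X\<^esub>"
    by (simp add: initial_value_def evolution_apply)
  show "initial_speed X (evolution F X) = functional G X \<zero>\<^bsub>RR X\<^esub>"
    by (simp add: initial_speed_def dot1 evolution_apply)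
qed

lemma half_sphere_eq_evolution: "half_sphere X = evolution even_part X"
  unfolding half_sphere_def evolution_def
proof (rule lam_cong)
  fix f t assume "cod f = X" "t \<in> El line (dom f)"
  have "of_q L (dom g) q = \<rho> g (of_q L (dom f) q)" if "cod g = dom f" for g q
    using \<rho>_of_q[of g q] that by simp
  then show "half (dom f) (sphere1 (dom f) t) = functional even_part (dom f) t"
    unfolding half_def pscale_def functional_def even_part_def sphere1_def
    by (intro lam_cong) (simp add: lam_apply)
qed

text \<open>
  By the fundamental theorem the integral from \<open>-t\<close> to \<open>t\<close> is a difference of values of the
  antiderivative, that is, twice its odd part.
\<close>

lemma half_ball_eq_evolution: "half_ball X = evolution (\<lambda>Y t \<psi>. odd_part Y t (antideriv Y \<psi>)) X"
  unfolding half_ball_def evolution_def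
proof (rule lam_cong)
  fix f t assume f: "cod f = X" and t: "t \<in> El line (dom f)"
  have "of_q L (dom g) q = \<rho> g (of_q L (dom f) q)" if "cod g = dom f" for g q
    using \<rho>_of_q[of g q] that by simp
  then show "half (dom f) (ball1 (dom f) t)
      = functional (\<lambda>Y t \<psi>. odd_part Y t (antideriv Y \<psi>)) (dom f) t"
    unfolding half_def pscale_def functional_def odd_part_def ball1_def using t
    by (intro lam_cong) (simp add: lam_apply antideriv_spec integral_eq[OF antideriv_spec(1,2)])
qed

text \<open>
  The odd part depends only on increments, and \<open>\<psi>\<close> is itself an antiderivative of \<open>\<psi>'\<close>.
\<close>

lemma odd_part_antideriv_deriv:
  assumes t: "t \<in> carrier (RR X)" and \<psi>: "\<psi> \<in> funs X"
  shows "odd_part X t (antideriv X (deriv X \<psi>)) = odd_part X t \<psi>"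
  using t \<psi> antideriv_increment_unique[of "antideriv X (deriv X \<psi>)" X "deriv X \<psi>" \<psi> "\<ominus>\<^bsub>RR X\<^esub> t" t]
  by (simp add: odd_part_def antideriv_spec is_deriv_deriv)

lemma even_part_zero:
  assumes "\<psi> \<in> funs X"
  shows "even_part X \<zero>\<^bsub>RR X\<^esub> \<psi> = \<psi> (ide X) \<zero>\<^bsub>RR X\<^esub>"
proof -
  interpret cring "RR X" by (rule line_cring)
  show ?thesis using assms by (simp add: even_part_def half_double)
qed

lemma odd_part_zero:
  assumes "\<psi> \<in> funs X"
  shows "odd_part X \<zero>\<^bsub>RR X\<^esub> \<psi> = \<zero>\<^bsub>RR X\<^esub>"
proof -
  interpret cring "RR X" by (rule line_cring)
  show ?thesis using assms by (simp add: odd_part_def a_minus_def r_neg)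
qed

lemma functional_even_part_zero: "functional even_part X \<zero>\<^bsub>RR X\<^esub> = dirac0 X"
  unfolding functional_def dirac0_def by (rule lam_cong) (simp add: \<rho>_ring even_part_zero)

lemma functional_odd_part_zero:
  assumes "linear_operator \<Phi>"
  shows "functional (\<lambda>Y t \<psi>. odd_part Y t (\<Phi> Y \<psi>)) X \<zero>\<^bsub>RR X\<^esub> = zero_distr X"
  unfolding functional_def zero_distr_def pzero_def
  using assms by (intro lam_cong) (simp add: \<rho>_ring odd_part_zero linear_operator_def)

theorem half_sphere_and_half_ball_solve_wave_equation:
  "wave_solution X (half_sphere X)"
  "initial_value X (half_sphere X) = dirac0 X"
  "initial_speed X (half_sphere X) = zero_distr X"
  "wave_solution X (half_ball X)"
  "initial_value X (half_ball X) = zero_distr X"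
  "initial_speed X (half_ball X) = dirac0 X"
proof -
  have "wave_solution X (half_sphere X) \<and>
    initial_value X (half_sphere X) = functional even_part X \<zero>\<^bsub>RR X\<^esub> \<and>
    initial_speed X (half_sphere X) = functional (\<lambda>Y t \<psi>. odd_part Y t (deriv Y \<psi>)) X \<zero>\<^bsub>RR X\<^esub>"
    unfolding half_sphere_eq_evolution
    by (intro conjI wave_solution_evolution[OF linear_family_even_part
          linear_family_operator[OF linear_family_odd_part linear_operator_deriv]])
      (simp_all add: even_odd_increment)
  then show "wave_solution X (half_sphere X)"
    "initial_value X (half_sphere X) = dirac0 X"
    "initial_speed X (half_sphere X) = zero_distr X"
    by (simp_all add: functional_even_part_zero functional_odd_part_zero linear_operator_deriv)
  have "wave_solution X (half_ball X) \<and>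
    initial_value X (half_ball X)
      = functional (\<lambda>Y t \<psi>. odd_part Y t (antideriv Y \<psi>)) X \<zero>\<^bsub>RR X\<^esub> \<and>
    initial_speed X (half_ball X) = functional even_part X \<zero>\<^bsub>RR X\<^esub>"
    unfolding half_ball_eq_evolution
    by (intro conjI wave_solution_evolution[OF
          linear_family_operator[OF linear_family_odd_part linear_operator_antideriv]
          linear_family_even_part])
      (simp_all add: even_odd_increment deriv_antideriv antideriv_spec odd_part_antideriv_deriv)
  then show "wave_solution X (half_ball X)"
    "initial_value X (half_ball X) = zero_distr X"
    "initial_speed X (half_ball X) = dirac0 X"
    by (simp_all add: functional_even_part_zero functional_odd_part_zero linear_operator_antideriv)
qed

end

theorem theorem16:
  fixes C :: "('o, 'm) site" and L :: "('o, 'm, 'r) sring" and X :: 'o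
  assumes "sdg_model C L"
  shows "ring_object.wave_solution C L X (ring_object.half_sphere C L X)
       \<and> ring_object.initial_value C L X (ring_object.half_sphere C L X) = ring_object.dirac0 C L X
       \<and> ring_object.initial_speed C L X (ring_object.half_sphere C L X) = ring_object.zero_distr C L X
       \<and> ring_object.wave_solution C L X (ring_object.half_ball C L X)
       \<and> ring_object.initial_value C L X (ring_object.half_ball C L X) = ring_object.zero_distr C L X
       \<and> ring_object.initial_speed C L X (ring_object.half_ball C L X) = ring_object.dirac0 C L X"
proof -
  interpret sdg_model C L by fact
  show ?thesis by (intro conjI half_sphere_and_half_ball_solve_wave_equation)
qed

end
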